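(* Let $\alpha=(\alpha_1,\dots,\alpha_k)$ be a weak composition with $k\ge1$, and let $\delta\in\mathbb P$. Write $\alpha+\delta=(\alpha_1+\delta,\dots,\alpha_k+\delta)$ and $\delta^r=(\delta,\dots,\delta)$ ($r$ entries). (1) If $\alpha_k>0$, then $Z\binom{\alpha}{\alpha+\delta}=M_\alpha$. (2) If $\alpha_k=0$, then $Z\binom{\alpha}{\alpha+\delta}=\frac{1}{|\mathfrak S_\alpha|}Z\binom{\alpha}{\beta}^{\mathfrak S_\alpha}$ for an arbitrary $\beta\in\mathbb P^k$. (3) If $\alpha_k>0$, then for every integer $s\ge0$ and every $\beta\in\mathbb P^k$, $$Z\tbinom{\alpha,0^s}{\beta,\delta^s}=Z\tbinom{\alpha,0^s}{\delta^{k+s}}.$$ (4) $Z\binom{\alpha}{\alpha+\delta}=Z\binom{\alpha}{\delta^k}$.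
   Context: $\mathbb P$ denotes the positive and $\mathbb N$ the nonnegative integers. A weak composition is a finite sequence of nonnegative integers. Let $X=\{x_i:i\in\mathbb P\}$ be commuting indeterminates. For $\alpha$ with $\alpha_k>0$, $M_\alpha=\sum_{0<i_1<\cdots<i_k}x_{i_1}^{\alpha_1}\cdots x_{i_k}^{\alpha_k}$. GSym. $\mathrm{GSym}\subseteq\mathbb Q[[X]]$ is the $\mathbb Q$-span of the series $\widehat M_{\binom{\gamma}{\mu}}=\sum_{0<i_1<\cdots<i_r}i_1^{\mu_1}\cdots i_r^{\mu_r}x_{i_1}^{\gamma_1}\cdots x_{i_r}^{\gamma_r}$, for $\gamma\in\mathbb N^r$ with $r=0$ or $\gamma_r>0$, and $\mu\in\mathbb N^r$. Regularization. For $\alpha\in\mathbb N^k$ and $\beta\in\mathbb P^k$, $\phi\binom{\alpha}{\beta}\in\mathrm{GSym}[t][z^{-1},z]]$ is obtained from $$\sum_{0<i_1<\cdots<i_k}x_{i_1}^{\alpha_1}\cdots x_{i_k}^{\alpha_k}e^{(i_1+t)\beta_1z}\cdots e^{(i_k+t)\beta_kz}$$ as follows. The coefficient of each $X$-monomial converges absolutely for $t\ge0$, $\mathrm{Re}(z)<0$. It is expanded as a Laurent series in $z$ with coefficients in $\mathbb Q[t]$, and powers are collected. Renormalization. Let $P$ be the projection onto the polar part in $z$. Set $\phi_-(\emptyset)=1$. For $k\ge 1$ define $$\phi_-\tbinom{\alpha}{\beta}=-P\big(\phi\tbinom{\alpha}{\beta}+\sum_{i=1}^{k-1}\phi\tbinom{\alpha_1..\alpha_i}{\beta_1..\beta_i}\phi_-\tbinom{\alpha_{i+1}..\alpha_k}{\beta_{i+1}..\beta_k}\big),$$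 $$\phi_+\tbinom{\alpha}{\beta}=(\mathrm{id}-P)\big(\text{same expression}\big).$$ Then $Z\binom{\alpha}{\beta}:=\phi_+\binom{\alpha}{\beta}\big|_{z=0}\in\mathrm{GSym}[t]$. Symmetrization. Let $j$ be the largest index with $\alpha_j>0$ ($j=0$ if none), $m=k-j$, and $\mathfrak S_\alpha=\mathfrak S_m$ the symmetric group on $\{1,\dots,m\}$. Define $$Z\tbinom{\alpha}{\beta}^{\mathfrak S_\alpha}=\sum_{\sigma\in\mathfrak S_m}Z\tbinom{\alpha_1,\dots,\alpha_k}{\beta_1,\dots,\beta_j,\beta_{j+\sigma(1)},\dots,\beta_{j+\sigma(m)}}.$$ *)

theory Defs
  imports "HOL-Complex_Analysis.Complex_Analysis" "HOL-Library.Poly_Mapping"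
    "HOL-Combinatorics.Permutations"
begin

text \<open>X-monomials: finitely supported exponent vectors (x_0 never occurs below).
  An element of Q[[X]] with coefficients in a ring 'c is a function from monomials to 'c.\<close>
type_synonym mon = "nat \<Rightarrow>\<^sub>0 nat"

definition tuples :: "nat \<Rightarrow> nat list set" where
  "tuples k = {is. length is = k \<and> sorted_wrt (<) is \<and> (\<forall>i\<in>set is. 0 < i)}"

definition tmon :: "nat list \<Rightarrow> nat list \<Rightarrow> mon" where
  "tmon a is = (\<Sum>j<length a. Poly_Mapping.single (is ! j) (a ! j))"

definition Mser :: "nat list \<Rightarrow> mon \<Rightarrow> rat poly" where
  "Mser a m = of_nat (card {is \<in> tuples (length a). tmon a is = m})"

definition xmul :: "(mon \<Rightarrow> 'c::comm_ring_1) \<Rightarrow> (mon \<Rightarrow> 'c) \<Rightarrow> mon \<Rightarrow> 'c" where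
  "xmul f g m = (\<Sum>p\<in>{(u, v). u + v = m}. f (fst p) * g (snd p))"

definition Scoef :: "nat list \<Rightarrow> nat list \<Rightarrow> mon \<Rightarrow> real \<Rightarrow> complex \<Rightarrow> complex" where
  "Scoef a b m t z = infsum (\<lambda>is. \<Prod>j<length a. exp (complex_of_real ((real (is ! j) + t) * real (b ! j)) * z))
      {is \<in> tuples (length a). tmon a is = m}"

definition fls_at :: "rat poly fls \<Rightarrow> real \<Rightarrow> complex fls" where
  "fls_at L t = Abs_fls (\<lambda>n. complex_of_real (poly (map_poly of_rat (fls_nth L n)) t))"

text \<open>phi(a;b): coefficientwise Laurent expansion in z, with coefficients in Q[t].\<close>
definition phi :: "nat list \<Rightarrow> nat list \<Rightarrow> mon \<Rightarrow> rat poly fls" where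
  "phi a b m = (THE L. \<forall>t::real. t \<ge> 0 \<longrightarrow>
      fls_conv_radius (fls_at L t) > 0 \<and>
      (\<forall>\<^sub>F z in at 0 within {z. Re z < 0}. eval_fls (fls_at L t) z = Scoef a b m t z))"

definition polar :: "'a::zero fls \<Rightarrow> 'a fls" where
  "polar F = Abs_fls (\<lambda>n. if n < 0 then fls_nth F n else 0)"

function phim :: "nat list \<Rightarrow> nat list \<Rightarrow> mon \<Rightarrow> rat poly fls" where
  "phim a b m = (if a = [] then (if m = 0 then 1 else 0)
     else - polar (phi a b m + (\<Sum>i\<in>{1..<length a}.
        xmul (phi (take i a) (take i b)) (phim (drop i a) (drop i b)) m)))"
  by pat_completeness auto
termination by (relation "Wellfounded.measure (\<lambda>(a, b, m). length a)") auto

definition phip :: "nat list \<Rightarrow> nat list \<Rightarrow> mon \<Rightarrow> rat poly fls" where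
  "phip a b m = (phi a b m + (\<Sum>i\<in>{1..<length a}.
        xmul (phi (take i a) (take i b)) (phim (drop i a) (drop i b)) m)) - polar (phi a b m + (\<Sum>i\<in>{1..<length a}.
        xmul (phi (take i a) (take i b)) (phim (drop i a) (drop i b)) m))"

definition Zv :: "nat list \<Rightarrow> nat list \<Rightarrow> mon \<Rightarrow> rat poly" where
  "Zv a b m = fls_nth (phip a b m) 0"

text \<open>Largest (1-based) index j with a_j > 0, or 0 if none.\<close>
definition lastpos :: "nat list \<Rightarrow> nat" where
  "lastpos a = (if \<forall>x\<in>set a. x = 0 then 0 else Suc (GREATEST i. i < length a \<and> 0 < a ! i))"

definition Zsym :: "nat list \<Rightarrow> nat list \<Rightarrow> mon \<Rightarrow> rat poly" where
  "Zsym a b m = (let j = lastpos a; r = length a - j in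
     \<Sum>\<sigma>\<in>{\<sigma>. \<sigma> permutes {0..<r}}. Zv a (take j b @ map (\<lambda>i. drop j b ! \<sigma> i) [0..<r]) m)"

definition symcard :: "nat list \<Rightarrow> nat" where
  "symcard a = card {\<sigma>. \<sigma> permutes {0..<length a - lastpos a}}"

end

theory Submission
  imports Defs "HOL-Combinatorics.Multiset_Permutations"
begin

text \<open>
  Write \<open>\<alpha> = (\<alpha>', 0\<^sup>r)\<close> where \<open>\<alpha>'\<close> is empty or ends in a positive entry. Then \<open>\<phi>\<close> of \<open>\<alpha>\<close> is a sum, over
  the finitely many index tuples \<open>i\<close> for \<open>\<alpha>'\<close> producing a given monomial, of a regular factor
  \<open>exp (\<dots> z)\<close> with value 1 at \<open>z = 0\<close>, times the sum \<open>\<Phi>\<^sub>n\<close> over \<open>n < i\<^sub>1 < \<dots> < i\<^sub>r\<close> belonging to the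
  trailing zeros, where \<open>n\<close> is the last entry of \<open>i\<close>.

  Let \<open>\<mu>\<close> be \<open>\<phi>\<^sub>-\<close> restricted to words of zeros. The deconcatenation product \<open>\<Phi>\<^sub>n * \<mu>\<close> is regular:
  this is the renormalisation for \<open>n = 0\<close>, and splitting off the terms with \<open>i\<^sub>1 = n + 1\<close> passes it
  from \<open>n\<close> to \<open>n + 1\<close>. Hence \<open>\<phi>\<^sub>-\<close> of \<open>\<alpha>\<close> vanishes when \<open>\<alpha>'\<close> is nonempty, and \<open>Z\<close> is the sum over
  \<open>i\<close> of the constant terms of \<open>\<Phi>\<^sub>n * \<mu>\<close>, which do not involve the \<open>\<beta>\<close>-entries below \<open>\<alpha>'\<close>.

  Moreover \<open>\<Phi>\<^sub>n\<close> and \<open>\<mu>\<close> are multiplicative for the quasi-shuffle product of a letter with a word,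
  and therefore so is \<open>\<Phi>\<^sub>n * \<mu>\<close>, whose constant term at a letter is \<open>-(t + n + 1/2)\<close> whatever the
  letter. By induction on the length, symmetrised constant terms do not depend on the word.
\<close>

section \<open>Quasi-shuffles of a letter with a word\<close>

text \<open>The terms of the quasi-shuffle product of the one-letter word \<open>[c]\<close> with
  \<open>w\<close>. A list, not a set, so that repeated terms keep their multiplicity.\<close>

fun stuffle1 :: "nat \<Rightarrow> nat list \<Rightarrow> nat list list" where
  "stuffle1 c [] = [[c]]"
| "stuffle1 c (b # w) = (c # b # w) # ((b + c) # w) # map ((#) b) (stuffle1 c w)"

abbreviation stuffle_sum :: "(nat list \<Rightarrow> 'a::comm_monoid_add) \<Rightarrow> nat \<Rightarrow> nat list \<Rightarrow> 'a" where
  "stuffle_sum f c w \<equiv> sum_list (map f (stuffle1 c w))"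

text \<open>The deconcatenation product. Peeling letters off the prefix matches the recursion of
  \<open>stuffle1\<close>, at the price of inductions that generalise \<open>f\<close>.\<close>

fun conv :: "(nat list \<Rightarrow> 'a::comm_ring_1) \<Rightarrow> (nat list \<Rightarrow> 'a) \<Rightarrow> nat list \<Rightarrow> 'a" where
  "conv f g [] = f [] * g []"
| "conv f g (b # w) = f [] * g (b # w) + conv (\<lambda>u. f (b # u)) g w"

lemma conv_conv_sum: "conv f g w = (\<Sum>i\<le>length w. f (take i w) * g (drop i w))"
  by (induction w arbitrary: f) (simp_all add: sum.atMost_Suc_shift del: sum.atMost_Suc)

lemma conv_add_left: "conv (\<lambda>u. f u + f' u) g w = conv f g w + conv f' g w"
  by (simp add: conv_conv_sum sum.distrib distrib_right)

lemma conv_cmult_left: "conv (\<lambda>u. c * f u) g w = c * conv f g w"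
  by (simp add: conv_conv_sum sum_distrib_left mult_ac)

lemma conv_cmult_right: "conv f (\<lambda>v. c * g v) w = c * conv f g w"
  by (simp add: conv_conv_sum sum_distrib_left mult_ac)

lemma conv_cong:
  assumes "\<And>u v. w = u @ v \<Longrightarrow> f u * g v = f' u * g' v"
  shows "conv f g w = conv f' g' w"
  unfolding conv_conv_sum by (intro sum.cong refl assms) simp

text \<open>A letter is primitive for deconcatenation: in each cut of a quasi-shuffle term,
  \<open>c\<close> has gone entirely into the prefix or entirely into the suffix.\<close>

lemma stuffle_sum_conv:
  "stuffle_sum (conv f g) c w = conv (stuffle_sum f c) g w + conv f (stuffle_sum g c) w"
proof (induction w arbitrary: f)
  case Nil
  show ?case by simp
next
  case (Cons b w)
  have "stuffle_sum (\<lambda>x. conv f g (b # x)) c w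
      = f [] * stuffle_sum (\<lambda>x. g (b # x)) c w + stuffle_sum (conv (\<lambda>u. f (b # u)) g) c w"
    by (simp add: sum_list_addf sum_list_const_mult)
  then show ?case
    by (simp add: o_def Cons.IH conv_add_left algebra_simps)
qed

text \<open>Separates insertions of \<open>c\<close>, which lengthen the word, from merges, which
  keep its length; symmetrisation treats the two differently.\<close>

lemma stuffle_sum_expand:
  "stuffle_sum f c w = (\<Sum>p\<le>length w. f (take p w @ c # drop p w))
      + (\<Sum>j<length w. f (w[j := w ! j + c]))"
proof (induction w arbitrary: f)
  case Nil
  show ?case by simp
next
  case (Cons b w)
  show ?case
    by (simp add: o_def Cons.IH sum.atMost_Suc_shift sum.lessThan_Suc_shift algebra_simps
        del: sum.lessThan_Suc sum.atMost_Suc)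
qed

lemma stuffle1_pos:
  assumes "x \<in> set (stuffle1 c w)" "0 < c" "\<forall>y\<in>set w. 0 < y"
  shows "\<forall>y\<in>set x. 0 < y" and "x \<noteq> []"
  using assms by (induction w arbitrary: x) auto

section \<open>Symmetrisation over the orderings of a finite set\<close>

text \<open>Removing \<open>a\<close> from an ordering of the larger set leaves an ordering of
  \<open>A\<close> and a position; as \<open>a\<close> is not in \<open>A\<close>, both are uniquely
  determined.\<close>

lemma sum_permutations_of_set_insert:
  assumes "finite A" "a \<notin> A"
  shows "(\<Sum>xs\<in>permutations_of_set (insert a A). f xs)
       = (\<Sum>xs\<in>permutations_of_set A. \<Sum>p\<le>length xs. f (take p xs @ a # drop p xs))"
proof -
  have "bij_betw (\<lambda>(xs, p). take p xs @ a # drop p xs)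
      (Sigma (permutations_of_set A) (\<lambda>xs. {..length xs})) (permutations_of_set (insert a A))"
  proof (rule bij_betwI')
    fix x y
    assume x: "x \<in> Sigma (permutations_of_set A) (\<lambda>xs. {..length xs})"
      and y: "y \<in> Sigma (permutations_of_set A) (\<lambda>xs. {..length xs})"
    obtain xs p where xp: "x = (xs, p)" by (cases x)
    obtain ys q where yq: "y = (ys, q)" by (cases y)
    have a: "a \<notin> set xs" "a \<notin> set ys"
      using x y assms by (auto simp: xp yq permutations_of_set_def)
    have "xs = ys \<and> p = q" if "take p xs @ a # drop p xs = take q ys @ a # drop q ys"
    proof -
      have "take p xs = take q ys \<and> drop p xs = drop q ys"
        using that a by (subst (asm) append_Cons_eq_iff) (auto dest: in_set_takeD in_set_dropD)
      moreover from this have "length (take p xs) = length (take q ys)" by simp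
      ultimately show ?thesis
        using x y xp yq by (metis SigmaD2 append_take_drop_id atMost_iff length_take min.absorb2)
    qed
    then show "((case x of (xs, p) \<Rightarrow> take p xs @ a # drop p xs)
        = (case y of (xs, p) \<Rightarrow> take p xs @ a # drop p xs)) = (x = y)"
      by (auto simp: xp yq)
  next
    fix x assume "x \<in> Sigma (permutations_of_set A) (\<lambda>xs. {..length xs})"
    then obtain xs p where xp: "x = (xs, p)" "xs \<in> permutations_of_set A" by blast
    have "set xs = A" "distinct xs" using xp by (auto simp: permutations_of_set_def)
    moreover from this have "distinct (take p xs @ drop p xs)" "set (take p xs @ drop p xs) = A"
      by simp_all
    ultimately show "(case x of (xs, p) \<Rightarrow> take p xs @ a # drop p xs)
        \<in> permutations_of_set (insert a A)"
      unfolding xp using assms(2)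
      by (auto simp: permutations_of_set_def simp del: append_take_drop_id dest: in_set_takeD in_set_dropD)
  next
    fix y assume "y \<in> permutations_of_set (insert a A)"
    then have y: "set y = insert a A" "distinct y" by (auto simp: permutations_of_set_def)
    then obtain us vs where uv: "y = us @ a # vs" by (metis insertI1 split_list)
    have "us @ vs \<in> permutations_of_set A"
      using y assms(2) unfolding uv by (auto simp: permutations_of_set_def)
    then show "\<exists>x\<in>Sigma (permutations_of_set A) (\<lambda>xs. {..length xs}).
        y = (case x of (xs, p) \<Rightarrow> take p xs @ a # drop p xs)"
      by (intro bexI[of _ "(us @ vs, length us)"]) (auto simp: uv)
  qed
  from sum.reindex_bij_betw[OF this, of f] show ?thesis
    by (subst sum.Sigma) (auto simp: case_prod_unfold)
qed

text \<open>Passes from permutations as functions, used in \<open>Zsym\<close>, to orderings as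
  lists, on which induction over the underlying set is possible.\<close>

lemma sum_permutes_eq_sum_permutations_of_set:
  "(\<Sum>\<sigma> | \<sigma> permutes {0..<r}. f (map \<sigma> [0..<r])) = (\<Sum>xs\<in>permutations_of_set {0..<r}. f xs)"
proof (rule sum.reindex_bij_betw)
  have inj: "inj_on (\<lambda>\<sigma>. map \<sigma> [0..<r]) {\<sigma>. \<sigma> permutes {0..<r}}"
  proof (rule inj_onI, clarsimp)
    fix \<sigma> \<tau> assume "\<sigma> permutes {0..<r}" "\<tau> permutes {0..<r}" "\<forall>x\<in>{0..<r}. \<sigma> x = \<tau> x"
    then show "\<sigma> = \<tau>" by (metis ext permutes_not_in)
  qed
  have sub: "(\<lambda>\<sigma>. map \<sigma> [0..<r]) ` {\<sigma>. \<sigma> permutes {0..<r}} \<subseteq> permutations_of_set {0..<r}"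
    by (auto simp: permutations_of_set_def permutes_image distinct_map permutes_inj_on)
  have "card ((\<lambda>\<sigma>. map \<sigma> [0..<r]) ` {\<sigma>. \<sigma> permutes {0..<r}}) = card (permutations_of_set {0..<r})"
    by (subst card_image[OF inj]) (simp add: card_permutations)
  then show "bij_betw (\<lambda>\<sigma>. map \<sigma> [0..<r]) {\<sigma>. \<sigma> permutes {0..<r}} (permutations_of_set {0..<r})"
    using inj sub by (simp add: bij_betw_def card_subset_eq)
qed

text \<open>A function that is multiplicative for the quasi-shuffle product and constant on letters is
  determined by that constant once its arguments are symmetrised, because merging two letters of a
  word only produces shorter words.\<close>
lemma symmetrised_stuffle_character:
  fixes \<rho> :: "nat list \<Rightarrow> 'a::comm_ring_1"
  assumes nil: "\<rho> [] = 1"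
    and letter: "\<And>c. 0 < c \<Longrightarrow> \<rho> [c] = s"
    and mult: "\<And>c w. 0 < c \<Longrightarrow> \<forall>y\<in>set w. 0 < y \<Longrightarrow> stuffle_sum \<rho> c w = \<rho> [c] * \<rho> w"
    and "finite A" "\<forall>x\<in>A. 0 < h x"
  shows "(\<Sum>xs\<in>permutations_of_set A. \<rho> (map h xs)) = (\<Prod>i<card A. s - of_nat i)"
  using assms(4,5)
proof (induction A arbitrary: h rule: finite_induct)
  case empty
  show ?case by (simp add: nil)
next
  case (insert a A)
  have ha: "0 < h a" and hA: "\<forall>x\<in>A. 0 < h x" using insert.prems by auto
  \<comment> \<open>Multiplicativity solved for the insertions. Merging \<open>a\<close> into
    \<open>x\<close> is recorded as a change of the labelling \<open>h\<close> at \<open>x\<close>,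
    so merged words are still indexed by orderings of \<open>A\<close>.\<close>
  have *: "(\<Sum>p\<le>length xs. \<rho> (map h (take p xs @ a # drop p xs)))
      = s * \<rho> (map h xs) - (\<Sum>x\<in>A. \<rho> (map (h(x := h x + h a)) xs))"
    if xs: "xs \<in> permutations_of_set A" for xs
  proof -
    have d: "distinct xs" "set xs = A" using xs by (auto simp: permutations_of_set_def)
    have upd: "(map h xs)[j := map h xs ! j + h a] = map (h(xs ! j := h (xs ! j) + h a)) xs"
      if "j < length xs" for j
      using that d by (intro nth_equalityI) (auto simp: nth_list_update nth_eq_iff_index_eq)
    have "s * \<rho> (map h xs) = stuffle_sum \<rho> (h a) (map h xs)"
      using mult[of "h a" "map h xs"] letter[OF ha] ha hA d by auto
    also have "\<dots> = (\<Sum>p\<le>length xs. \<rho> (map h (take p xs @ a # drop p xs)))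
        + (\<Sum>j<length xs. \<rho> (map (h(xs ! j := h (xs ! j) + h a)) xs))"
      unfolding stuffle_sum_expand using upd by (simp add: take_map drop_map)
    also have "(\<Sum>j<length xs. \<rho> (map (h(xs ! j := h (xs ! j) + h a)) xs))
        = (\<Sum>x\<in>A. \<rho> (map (h(x := h x + h a)) xs))"
      by (rule sum.reindex_bij_betw) (use d in \<open>auto intro: bij_betw_nth\<close>)
    finally show ?thesis by (simp add: algebra_simps)
  qed
  have "(\<Sum>xs\<in>permutations_of_set (insert a A). \<rho> (map h xs))
      = (\<Sum>xs\<in>permutations_of_set A. s * \<rho> (map h xs) - (\<Sum>x\<in>A. \<rho> (map (h(x := h x + h a)) xs)))"
    by (simp only: sum_permutations_of_set_insert[OF insert.hyps] * cong: sum.cong)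
  also have "\<dots> = s * (\<Sum>xs\<in>permutations_of_set A. \<rho> (map h xs))
      - (\<Sum>x\<in>A. \<Sum>xs\<in>permutations_of_set A. \<rho> (map (h(x := h x + h a)) xs))"
    by (simp add: sum_subtractf sum_distrib_left sum.swap[of _ A])
  \<comment> \<open>The induction hypothesis is used for \<open>h\<close> and for each relabelling;
    all of them give the same product, so the merges contribute \<open>card A\<close> copies of
    it.\<close>
  also have "\<dots> = (s - of_nat (card A)) * (\<Prod>i<card A. s - of_nat i)"
    using insert.IH[OF hA] insert.IH hA ha by (simp add: algebra_simps)
  finally show ?case using insert.hyps by (simp add: mult.commute)
qed

section \<open>Geometric series in the ring of Laurent series\<close>

lemma smult_sum_right: "smult c (\<Sum>x\<in>A. f x) = (\<Sum>x\<in>A. smult c (f x))"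
  by (induction A rule: infinite_finite_induct) (auto simp: smult_add_right)

text \<open>The series of \<open>exp (x z)\<close> in \<open>z\<close>. Its coefficients lie in a
  ring that is not a field, so division by \<open>k!\<close> is a scalar multiplication.\<close>

definition fexp :: "rat poly \<Rightarrow> rat poly fps" where
  "fexp x = Abs_fps (\<lambda>k. smult (inverse (fact k)) (x ^ k))"

lemma fexp_nth: "fps_nth (fexp x) k = smult (inverse (fact k)) (x ^ k)"
  by (simp add: fexp_def)

lemma fexp_0 [simp]: "fexp 0 = 1"
  by (rule fps_ext) (auto simp: fexp_nth power_0_left)

lemma fexp_add: "fexp (x + y) = fexp x * fexp y"
proof (rule fps_ext)
  fix n
  have "fps_nth (fexp x * fexp y) n
      = (\<Sum>k\<le>n. smult (inverse (fact k) * inverse (fact (n - k))) (x ^ k * y ^ (n - k)))"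
    by (simp add: fps_mult_nth fexp_nth atLeast0AtMost mult.commute)
  also have "\<dots> = (\<Sum>k\<le>n. smult (inverse (fact n)) (of_nat (n choose k) * x ^ k * y ^ (n - k)))"
  proof (intro sum.cong refl)
    fix k assume "k \<in> {..n}"
    then have "k \<le> n" by simp
    then have "(inverse (fact k) * inverse (fact (n - k)) :: rat) = inverse (fact n) * of_nat (n choose k)"
      by (simp add: binomial_fact field_simps)
    then show "smult (inverse (fact k) * inverse (fact (n - k))) (x ^ k * y ^ (n - k))
        = smult (inverse (fact n)) (of_nat (n choose k) * x ^ k * y ^ (n - k))"
      by (simp add: of_nat_poly)
  qed
  also have "\<dots> = smult (inverse (fact n)) ((x + y) ^ n)"
    unfolding binomial_ring by (rule smult_sum_right[symmetric])
  finally show "fps_nth (fexp (x + y)) n = fps_nth (fexp x * fexp y) n"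
    by (simp add: fexp_nth)
qed

definition flexp :: "rat poly \<Rightarrow> rat poly fls" where
  "flexp x = fps_to_fls (fexp x)"

lemma flexp_0 [simp]: "flexp 0 = 1"
  by (simp add: flexp_def)

lemma flexp_add: "flexp (x + y) = flexp x * flexp y"
  by (simp add: flexp_def fexp_add fls_times_fps_to_fls)

text \<open>The inverse of \<open>1 - exp (B z)\<close>, built by hand since \<open>rat poly\<close> is not a field (junk for
  \<open>B = 0\<close>).\<close>
definition inv_one_minus_exp :: "nat \<Rightarrow> rat poly fls" where
  "inv_one_minus_exp B = fls_X_inv *
     fps_to_fls (fps_right_inverse (fps_shift 1 (1 - fexp (of_nat B))) [:- 1 / of_nat B:])"

text \<open>\<open>1 - exp (B z)\<close> is \<open>z\<close> times a series \<open>u\<close> with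
  constant term \<open>-B\<close>, a unit. Comparing coefficients in \<open>u * v = 1\<close> gives
  the start of \<open>v\<close>; its entry \<open>1/2\<close> will be the \<open>1/2\<close> in the
  constant term at a letter.\<close>

lemma inv_one_minus_exp_cases:
  assumes "0 < B"
  obtains u v where "inv_one_minus_exp B = fls_X_inv * fps_to_fls v"
    and "1 - flexp (of_nat B) = fls_X * fps_to_fls u" and "u * v = 1"
    and "fps_nth v 0 = [:- 1 / of_nat B:]" and "fps_nth v 1 = [:1 / 2:]"
proof -
  define u where "u = fps_shift 1 (1 - fexp (of_nat B))"
  define v where "v = fps_right_inverse u [:- 1 / of_nat B:]"
  have "fps_nth (1 - fexp (of_nat B)) 0 = 0" by (simp add: fexp_nth)
  then have u: "fps_X * u = 1 - fexp (of_nat B)"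
    by (intro fps_ext) (auto simp: u_def fps_X_mult_nth)
  have u0: "fps_nth u 0 = [:- of_nat B:]"
    by (simp add: u_def fexp_nth of_nat_poly)
  have u1: "fps_nth u 1 = [:- (of_nat B ^ 2 / 2):]"
    by (simp add: u_def fexp_nth of_nat_poly numeral_2_eq_2)
  have uv: "u * v = 1"
    unfolding v_def by (rule fps_right_inverse) (use assms u0 in \<open>simp add: one_pCons\<close>)
  have iB: "[:- 1 / of_nat B:] * fps_nth u 0 = 1"
    using assms by (simp add: u0 one_pCons)
  have left_inv: "p = [:- 1 / of_nat B:] * (fps_nth u 0 * p)" for p
    by (simp only: iB mult_1 flip: mult.assoc)
  have "fps_nth u 0 * fps_nth v 0 = 1"
    using arg_cong[OF uv, of "\<lambda>f. fps_nth f 0"] by (simp add: fps_mult_nth)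
  then have v0: "fps_nth v 0 = [:- 1 / of_nat B:]"
    using left_inv[of "fps_nth v 0"] by (simp only: mult_1_right)
  have "fps_nth u 0 * fps_nth v 1 = - (fps_nth u 1 * fps_nth v 0)"
    using arg_cong[OF uv, of "\<lambda>f. fps_nth f 1"]
    by (simp add: fps_mult_nth eq_neg_iff_add_eq_0)
  then have "fps_nth v 1 = [:- 1 / of_nat B:] * - (fps_nth u 1 * fps_nth v 0)"
    using left_inv[of "fps_nth v 1"] by (simp only:)
  also have "\<dots> = [:1 / 2:]"
    using assms unfolding u1 v0 by (simp add: power2_eq_square)
  finally have v1: "fps_nth v 1 = [:1 / 2:]" .
  have "1 - flexp (of_nat B) = fps_to_fls (1 - fexp (of_nat B))"
    by (simp add: flexp_def)
  also have "\<dots> = fls_X * fps_to_fls u"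
    by (simp flip: u add: fls_times_fps_to_fls)
  finally show ?thesis
    using that[of v u] uv v0 v1 by (simp add: inv_one_minus_exp_def u_def v_def)
qed

lemma inv_one_minus_exp:
  assumes "0 < B"
  shows "inv_one_minus_exp B * (1 - flexp (of_nat B)) = 1"
proof -
  obtain u v where uv: "inv_one_minus_exp B = fls_X_inv * fps_to_fls v"
    "1 - flexp (of_nat B) = fls_X * fps_to_fls u" "u * v = 1"
    using inv_one_minus_exp_cases[OF assms] by blast
  have X: "fls_X_inv * fls_X = (1 :: rat poly fls)"
    by (simp add: fls_X_inv_times_conv_shift)
  have "inv_one_minus_exp B * (1 - flexp (of_nat B)) = (fls_X_inv * fls_X) * fps_to_fls (u * v)"
    by (simp only: uv(1,2) fls_times_fps_to_fls mult_ac)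
  then show ?thesis by (simp only: X uv) simp
qed

text \<open>For \<open>B > 0\<close>, the expansion of the sum of \<open>exp (k B z)\<close> over
  \<open>k \<ge> 1\<close>.\<close>

definition geom :: "nat \<Rightarrow> rat poly fls" where
  "geom B = flexp (of_nat B) * inv_one_minus_exp B"

lemma geom_mult: "0 < B \<Longrightarrow> geom B * (1 - flexp (of_nat B)) = flexp (of_nat B)"
  using inv_one_minus_exp[of B] by (simp add: geom_def mult.assoc)

text \<open>Splits a double sum over pairs of positive integers \<open>i\<close>, \<open>j\<close>
  into \<open>i < j\<close>, \<open>i = j\<close> and \<open>i > j\<close>. The proof clears the
  denominators and cancels them, Laurent series over \<open>rat poly\<close> having no zero
  divisors.\<close>

lemma geom_stuffle:
  assumes "0 < x" "0 < y"
  shows "geom (x + y) * (geom x + 1 + geom y) = geom x * geom y"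
proof -
  let ?p = "flexp (of_nat x)" and ?q = "flexp (of_nat y)"
  note g = geom_mult[OF assms(1)] geom_mult[OF assms(2)]
  have gxy: "geom (x + y) * (1 - ?p * ?q) = ?p * ?q"
    using geom_mult[of "x + y"] assms by (simp add: flexp_add)
  have nz: "1 - ?p \<noteq> 0" "1 - ?q \<noteq> 0"
    using inv_one_minus_exp[OF assms(1)] inv_one_minus_exp[OF assms(2)] by auto
  have "(geom x + 1 + geom y) * ((1 - ?p) * (1 - ?q))
      = (geom x * (1 - ?p)) * (1 - ?q) + (1 - ?p) * (1 - ?q) + (geom y * (1 - ?q)) * (1 - ?p)"
    by (simp add: algebra_simps)
  also have "\<dots> = 1 - ?p * ?q" unfolding g by (simp add: algebra_simps)
  finally have "geom (x + y) * (geom x + 1 + geom y) * ((1 - ?p) * (1 - ?q)) = ?p * ?q"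
    using gxy by (simp add: mult.assoc)
  also have "\<dots> = geom x * geom y * ((1 - ?p) * (1 - ?q))"
    using g by (simp add: mult_ac)
  finally show ?thesis using nz by simp
qed

section \<open>Iterated geometric sums over increasing indices\<close>

text \<open>Taking the gaps between consecutive indices as variables turns the iterated sum into a
  product over suffixes of the word.\<close>

fun geom_word :: "nat list \<Rightarrow> rat poly fls" where
  "geom_word [] = 1"
| "geom_word (b # w) = geom (b + sum_list w) * geom_word w"

text \<open>\<open>Phi n b\<close> is the Laurent expansion of the sum over \<open>n < i\<^sub>1 < \<dots> < i\<^sub>r\<close> of the product of the
  \<open>exp ((i\<^sub>j + t) b\<^sub>j z)\<close>, the variable of \<open>rat poly\<close> being \<open>t\<close>.\<close>
definition Phi :: "nat \<Rightarrow> nat list \<Rightarrow> rat poly fls" where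
  "Phi n b = flexp (of_nat (sum_list b) * [:of_nat n, 1:]) * geom_word b"

lemma Phi_Nil [simp]: "Phi n [] = 1"
  by (simp add: Phi_def)

lemma sum_list_stuffle1: "x \<in> set (stuffle1 c w) \<Longrightarrow> sum_list x = c + sum_list w"
  by (induction w arbitrary: x) auto

text \<open>All terms have the same letter sum, hence the same leading factor \<open>geom\<close>;
  the three kinds of terms then combine by \<open>geom_stuffle\<close>.\<close>

lemma geom_word_stuffle:
  assumes "0 < c" "\<forall>y\<in>set w. 0 < y"
  shows "stuffle_sum geom_word c w = geom c * geom_word w"
  using assms(2)
proof (induction w)
  case Nil
  show ?case by simp
next
  case (Cons b w)
  have "stuffle_sum (geom_word \<circ> (#) b) c w
      = stuffle_sum (\<lambda>x. geom (c + (b + sum_list w)) * geom_word x) c w"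
    by (intro arg_cong[of _ _ sum_list] map_cong refl) (simp add: sum_list_stuffle1 add_ac)
  then have "stuffle_sum geom_word c (b # w)
      = geom (c + (b + sum_list w)) * (geom c + 1 + geom (b + sum_list w)) * geom_word w"
    unfolding sum_list_const_mult using Cons by (simp add: algebra_simps)
  also have "\<dots> = geom c * geom_word (b # w)"
    using geom_stuffle[of c "b + sum_list w"] assms(1) Cons.prems by simp
  finally show ?case .
qed

lemma Phi_stuffle:
  assumes "0 < c" "\<forall>y\<in>set w. 0 < y"
  shows "stuffle_sum (Phi n) c w = Phi n [c] * Phi n w"
proof -
  have "stuffle_sum (Phi n) c w
      = stuffle_sum (\<lambda>x. flexp (of_nat (c + sum_list w) * [:of_nat n, 1:]) * geom_word x) c w"
    by (intro arg_cong[of _ _ sum_list] map_cong refl) (simp only: Phi_def sum_list_stuffle1)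
  also have "\<dots> = flexp (of_nat (c + sum_list w) * [:of_nat n, 1:]) * (geom c * geom_word w)"
    by (simp only: sum_list_const_mult geom_word_stuffle[OF assms])
  also have "\<dots> = Phi n [c] * Phi n w"
    by (simp add: Phi_def flexp_add distrib_right mult_ac del: mult_pCons_left mult_pCons_right)
  finally show ?thesis .
qed

text \<open>Splits off the terms with first index \<open>n + 1\<close>. Raising \<open>n\<close> by
  one multiplies the prefactor by \<open>exp (B z)\<close>, \<open>B\<close> being the letter sum,
  so the difference telescopes by \<open>geom_mult\<close>.\<close>

lemma Phi_Cons:
  assumes "0 < b"
  shows "Phi n (b # w) = Phi (Suc n) (b # w)
      + flexp (of_nat b * [:of_nat (Suc n), 1:]) * Phi (Suc n) w"
proof -
  define B where "B = b + sum_list w"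
  have B: "0 < B" using assms by (simp add: B_def)
  have eq: "[:of_nat (Suc n), 1:] = (1 :: rat poly) + [:of_nat n, 1:]"
    by (simp add: one_pCons)
  let ?x = "[:of_nat n, 1:] :: rat poly"
  have 1: "flexp (of_nat B * [:of_nat (Suc n), 1:]) = flexp (of_nat B) * flexp (of_nat B * ?x)"
    unfolding eq by (simp add: distrib_left flexp_add)
  have 2: "flexp (of_nat B * [:of_nat (Suc n), 1:])
      = flexp (of_nat b * [:of_nat (Suc n), 1:]) * flexp (of_nat (sum_list w) * [:of_nat (Suc n), 1:])"
    by (simp add: B_def distrib_right flexp_add del: mult_pCons_left mult_pCons_right)
  have "Phi n (b # w) - Phi (Suc n) (b # w)
      = flexp (of_nat B * ?x) * (geom B * (1 - flexp (of_nat B))) * geom_word w"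
    unfolding Phi_def sum_list.Cons geom_word.simps B_def[symmetric] 1
    by (simp add: algebra_simps del: mult_pCons_left mult_pCons_right)
  also have "\<dots> = flexp (of_nat B * [:of_nat (Suc n), 1:]) * geom_word w"
    using geom_mult[OF B] 1 by (simp add: mult_ac)
  also have "\<dots> = flexp (of_nat b * [:of_nat (Suc n), 1:]) * Phi (Suc n) w"
    unfolding 2 Phi_def by (simp only: mult_ac)
  finally show ?thesis by (simp add: algebra_simps)
qed

text \<open>The pole has residue \<open>-1/c\<close> and the exponential has linear coefficient
  \<open>c * (n + 1 + t)\<close>, so \<open>c\<close> cancels and \<open>1/2 - (n + 1 + t)\<close>
  remains.\<close>

lemma Phi_letter_const:
  assumes "0 < c"
  shows "fls_nth (Phi n [c]) 0 = [:- of_nat n - 1 / 2, - 1:]"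
proof -
  obtain v where v: "inv_one_minus_exp c = fls_X_inv * fps_to_fls v"
    "fps_nth v 0 = [:- 1 / of_nat c:]" "fps_nth v 1 = [:1 / 2:]"
    using inv_one_minus_exp_cases[OF assms] by metis
  define x where "x = of_nat c * [:of_nat n, 1:] + (of_nat c :: rat poly)"
  have "Phi n [c] = fls_X_inv * fps_to_fls (fexp x * v)"
    by (simp add: Phi_def geom_def v(1) x_def fexp_add flexp_def fls_times_fps_to_fls mult_ac
        del: mult_pCons_left mult_pCons_right fls_X_inv_times_conv_shift)
  then have "fls_nth (Phi n [c]) 0 = fps_nth (fexp x * v) 1"
    by (simp add: fls_X_inv_times_conv_shift)
  also have "\<dots> = fps_nth v 1 + x * fps_nth v 0"
    by (simp add: fps_mult_nth fexp_nth)
  also have "\<dots> = [:- of_nat n - 1 / 2, - 1:]"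
    unfolding v x_def using assms by (simp add: of_nat_poly field_simps)
  finally show ?thesis .
qed

section \<open>Polar and regular parts\<close>

definition regular :: "'a::zero fls \<Rightarrow> bool" where
  "regular F \<longleftrightarrow> (\<forall>n<0. fls_nth F n = 0)"

lemma nth_polar: "fls_nth (polar F) n = (if n < 0 then fls_nth F n else 0)"
  unfolding polar_def
  by (subst nth_Abs_fls_lower_bound[where N = "fls_subdegree F"]) auto

lemma polar_eq_0_iff: "polar F = 0 \<longleftrightarrow> regular F"
  by (auto simp: fls_eq_iff nth_polar regular_def)

lemma regular_diff_polar: "regular (F - polar F)" for F :: "'a::ab_group_add fls"
  by (simp add: regular_def nth_polar)

lemma regular_add: "regular F \<Longrightarrow> regular G \<Longrightarrow> regular (F + G)" for F :: "'a::ab_group_add fls"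
  by (simp add: regular_def)

lemma regular_diff: "regular F \<Longrightarrow> regular G \<Longrightarrow> regular (F - G)" for F :: "'a::ab_group_add fls"
  by (simp add: regular_def)

lemma regular_sum: "(\<And>x. x \<in> A \<Longrightarrow> regular (F x)) \<Longrightarrow> regular (sum F A)"
  for F :: "'b \<Rightarrow> 'a::ab_group_add fls"
  by (simp add: regular_def fls_nth_sum)

lemma regular_mult:
  fixes F G :: "'a::comm_ring_1 fls"
  assumes "regular F" "regular G"
  shows "regular (F * G)" and "fls_nth (F * G) 0 = fls_nth F 0 * fls_nth G 0"
proof -
  show "regular (F * G)"
    unfolding regular_def
  proof (intro allI impI)
    fix n :: int assume "n < 0"
    then show "fls_nth (F * G) n = 0"
      unfolding fls_times_nth(2) using assms unfolding regular_def
      by (intro sum.neutral) (metis diff_ge_0_iff_ge linorder_not_less mult_eq_0_iff mult_zero_left mult_zero_right order.strict_trans2)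
  qed
  have F: "F = fps_to_fls (fls_regpart F)" and G: "G = fps_to_fls (fls_regpart G)"
    using assms by (auto simp: regular_def fls_eq_iff)
  have "fls_nth (F * G) 0 = fls_nth (fps_to_fls (fls_regpart F * fls_regpart G)) 0"
    using F G by (simp add: fls_times_fps_to_fls)
  then show "fls_nth (F * G) 0 = fls_nth F 0 * fls_nth G 0" by simp
qed

lemma regular_flexp: "regular (flexp x)"
  by (simp add: regular_def flexp_def)

lemma flexp_nth_0: "fls_nth (flexp x) 0 = 1"
  by (simp add: flexp_def fexp_nth)

text \<open>If \<open>n \<ge> 0\<close>, then \<open>i\<close> and \<open>n - i\<close> cannot both
  be negative.\<close>

lemma polar_times_polar:
  fixes F G :: "'a::comm_ring_1 fls"
  assumes "\<forall>n\<ge>0. fls_nth F n = 0" "\<forall>n\<ge>0. fls_nth G n = 0"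
  shows "\<forall>n\<ge>0. fls_nth (F * G) n = 0"
proof (intro allI impI)
  fix n :: int assume "0 \<le> n"
  show "fls_nth (F * G) n = 0"
    unfolding fls_times_nth(2)
  proof (intro sum.neutral ballI)
    fix i
    show "fls_nth F i * fls_nth G (n - i) = 0"
      using assms \<open>0 \<le> n\<close> by (cases "i \<ge> 0") auto
  qed
qed

section \<open>Laurent expansions with polynomial coefficients\<close>

text \<open>The coefficient map of \<open>fls_at\<close>, isolated because it is a ring
  homomorphism; \<open>fls_at\<close> inherits this property.\<close>

definition poly_at :: "real \<Rightarrow> rat poly \<Rightarrow> complex" where
  "poly_at t p = complex_of_real (poly (map_poly of_rat p) t)"

lemma poly_at_pCons [simp]: "poly_at t (pCons c p) = of_real (of_rat c) + of_real t * poly_at t p"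
  by (simp add: poly_at_def map_poly_pCons)

lemma poly_at_0 [simp]: "poly_at t 0 = 0"
  by (simp add: poly_at_def)

lemma poly_at_add [simp]: "poly_at t (p + q) = poly_at t p + poly_at t q"
  by (induction p q rule: poly_induct2) (simp_all add: of_rat_add algebra_simps)

lemma poly_at_smult [simp]: "poly_at t (smult c p) = of_real (of_rat c) * poly_at t p"
  by (simp add: poly_at_def map_poly_smult of_rat_mult)

lemma poly_at_mult [simp]: "poly_at t (p * q) = poly_at t p * poly_at t q"
  by (induction p) (simp_all add: algebra_simps)

lemma poly_at_1 [simp]: "poly_at t 1 = 1"
  by (simp add: one_pCons)

lemma poly_at_power [simp]: "poly_at t (p ^ n) = poly_at t p ^ n"
  by (induction n) simp_all

lemma poly_at_sum [simp]: "poly_at t (\<Sum>x\<in>A. f x) = (\<Sum>x\<in>A. poly_at t (f x))"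
  by (induction A rule: infinite_finite_induct) simp_all

lemma poly_at_of_nat [simp]: "poly_at t (of_nat n) = of_nat n"
  by (simp add: of_nat_poly)

lemma fls_at_nth [simp]: "fls_nth (fls_at L t) n = poly_at t (fls_nth L n)"
  unfolding fls_at_def poly_at_def[symmetric]
  by (subst nth_Abs_fls_lower_bound[where N = "fls_subdegree L"]) auto

lemma fls_at_0 [simp]: "fls_at 0 t = 0"
  by (simp add: fls_eq_iff)

lemma fls_at_1 [simp]: "fls_at 1 t = 1"
  by (simp add: fls_eq_iff)

lemma fls_at_add [simp]: "fls_at (L + M) t = fls_at L t + fls_at M t"
  by (simp add: fls_eq_iff)

lemma fls_at_diff [simp]: "fls_at (L - M) t = fls_at L t - fls_at M t"
  using fls_at_add[of "L - M" M t] by (simp add: algebra_simps)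

lemma fls_at_sum [simp]: "fls_at (\<Sum>x\<in>A. f x) t = (\<Sum>x\<in>A. fls_at (f x) t)"
  by (induction A rule: infinite_finite_induct) simp_all

lemma fls_at_shift: 
  "fls_at (fls_shift n (fps_to_fls f)) t
     = fls_shift n (fps_to_fls (Abs_fps (\<lambda>k. poly_at t (fps_nth f k))))"
  by (auto simp: fls_eq_iff)

lemma fls_at_mult [simp]: "fls_at (L * M) t = fls_at L t * fls_at M t"
proof -
  obtain l where l: "L = fls_shift (- fls_subdegree L) (fps_to_fls l)"
    using fls_as_fps[of L] by blast
  obtain m where m: "M = fls_shift (- fls_subdegree M) (fps_to_fls m)"
    using fls_as_fps[of M] by blast
  have "Abs_fps (\<lambda>k. poly_at t (fps_nth (l * m) k))
      = Abs_fps (\<lambda>k. poly_at t (fps_nth l k)) * Abs_fps (\<lambda>k. poly_at t (fps_nth m k))"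
    by (rule fps_ext) (simp add: fps_mult_nth)
  then show ?thesis
    by (metis (no_types) l m fls_times_both_shifted_simp fls_at_shift fls_times_fps_to_fls)
qed

lemma fls_at_flexp: "fls_at (flexp x) t = fps_to_fls (fps_exp (poly_at t x))"
proof -
  have "real_of_rat (inverse (fact k)) = inverse (fact k)" for k
    by (metis of_rat_inverse of_nat_fact of_rat_of_nat_eq)
  then show ?thesis
    by (simp add: fls_eq_iff flexp_def fexp_nth divide_inverse mult.commute)
qed

lemma has_laurent_expansion_flexp:
  "(\<lambda>z. exp (poly_at t x * z)) has_laurent_expansion fls_at (flexp x) t"
  unfolding fls_at_flexp by (intro has_laurent_expansion_fps has_fps_expansion_exp)

text \<open>After evaluation at \<open>t\<close> the coefficients lie in a field, so
  \<open>geom_mult\<close> exhibits the series as a genuine quotient; its denominator is nonzero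
  because it has an inverse.\<close>

lemma has_laurent_expansion_geom:
  fixes t :: real
  assumes "0 < B"
  shows "(\<lambda>z. exp (of_nat B * z) / (1 - exp (of_nat B * z))) has_laurent_expansion fls_at (geom B) t"
proof -
  have E: "(\<lambda>z. exp (of_nat B * z)) has_laurent_expansion fls_at (flexp (of_nat B)) t"
    using has_laurent_expansion_flexp[of t "of_nat B"] by simp
  have "fls_at (geom B) t * (1 - fls_at (flexp (of_nat B)) t) = fls_at (flexp (of_nat B)) t"
    using arg_cong[OF geom_mult[OF assms], of "\<lambda>L. fls_at L t"] by simp
  moreover have "fls_at (inv_one_minus_exp B) t * (1 - fls_at (flexp (of_nat B)) t) = 1"
    using arg_cong[OF inv_one_minus_exp[OF assms], of "\<lambda>L. fls_at L t"] by simp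
  then have "1 - fls_at (flexp (of_nat B)) t \<noteq> 0" by auto
  ultimately have "fls_at (geom B) t = fls_at (flexp (of_nat B)) t / (1 - fls_at (flexp (of_nat B)) t)"
    by (simp add: nonzero_eq_divide_eq)
  then show ?thesis
    using E by (auto intro!: has_laurent_expansion_divide has_laurent_expansion_diff)
qed

text \<open>Gives access to the definite description in \<open>phi\<close>. Uniqueness has two
  stages: first the expansions agree for each fixed \<open>t \<ge> 0\<close>, then the polynomial
  coefficients agree.\<close>

lemma phi_eqI:
  assumes "\<And>t. t \<ge> 0 \<Longrightarrow> \<exists>f. f has_laurent_expansion fls_at L t
      \<and> (\<forall>z. Re z < 0 \<longrightarrow> f z = Scoef a b m t z)"
  shows "phi a b m = L"
  unfolding phi_def
proof (rule the_equality)
  have ev: "eventually (\<lambda>z. z \<in> {z. Re z < 0}) (at 0 within {z. Re z < 0})"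
    by (simp add: eventually_at_filter)
  show L: "\<forall>t\<ge>0. 0 < fls_conv_radius (fls_at L t) \<and>
      (\<forall>\<^sub>F z in at 0 within {z. Re z < 0}. eval_fls (fls_at L t) z = Scoef a b m t z)"
  proof (intro allI impI)
    fix t :: real assume "0 \<le> t"
    then obtain f where f: "f has_laurent_expansion fls_at L t" "\<forall>z. Re z < 0 \<longrightarrow> f z = Scoef a b m t z"
      using assms by blast
    have "eventually (\<lambda>z. eval_fls (fls_at L t) z = f z) (at 0 within {z. Re z < 0})"
      using f(1) unfolding has_laurent_expansion_def
      by (auto elim: filter_leD[OF at_le, rotated])
    with ev have "\<forall>\<^sub>F z in at 0 within {z. Re z < 0}. eval_fls (fls_at L t) z = Scoef a b m t z"
      by eventually_elim (use f(2) in auto)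
    then show "0 < fls_conv_radius (fls_at L t) \<and>
        (\<forall>\<^sub>F z in at 0 within {z. Re z < 0}. eval_fls (fls_at L t) z = Scoef a b m t z)"
      using f(1) by (simp add: has_laurent_expansion_def)
  qed
  fix M
  assume M: "\<forall>t\<ge>0. 0 < fls_conv_radius (fls_at M t) \<and>
      (\<forall>\<^sub>F z in at 0 within {z. Re z < 0}. eval_fls (fls_at M t) z = Scoef a b m t z)"
  have at: "fls_at M t = fls_at L t" if t: "0 \<le> t" for t
  proof (rule ccontr)
    assume "fls_at M t \<noteq> fls_at L t"
    then have nz: "fls_at M t - fls_at L t \<noteq> 0" by simp
    \<comment> \<open>A nonzero Laurent expansion forces nonzero values near 0, but the difference
      vanishes in the left half-plane, which accumulates at 0.\<close>
    have "(\<lambda>z. eval_fls (fls_at M t) z - eval_fls (fls_at L t) z)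
        has_laurent_expansion fls_at M t - fls_at L t"
      using L M t by (intro has_laurent_expansion_diff) (auto simp: has_laurent_expansion_def)
    from has_laurent_expansion_nonzero_imp_eventually_nonzero[OF this nz]
    have "\<forall>\<^sub>F z in at 0 within {z. Re z < 0}. eval_fls (fls_at M t) z - eval_fls (fls_at L t) z \<noteq> 0"
      by (rule filter_leD[OF at_le, rotated]) simp
    moreover have "\<forall>\<^sub>F z in at 0 within {z. Re z < 0}. eval_fls (fls_at M t) z = Scoef a b m t z"
      "\<forall>\<^sub>F z in at 0 within {z. Re z < 0}. eval_fls (fls_at L t) z = Scoef a b m t z"
      using L M t by auto
    ultimately have "\<forall>\<^sub>F z::complex in at 0 within {z. Re z < 0}. False"
      by eventually_elim simp
    moreover have "(0 :: complex) islimpt {z. Re z < 0}"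
      unfolding islimpt_approachable
    proof (intro allI impI)
      fix e :: real assume "0 < e"
      then show "\<exists>x\<in>{z. Re z < 0}. x \<noteq> 0 \<and> dist x 0 < e"
        by (intro bexI[of _ "complex_of_real (- e / 2)"]) (auto simp: norm_divide)
    qed
    ultimately show False
      by (simp add: trivial_limit_within eventually_False)
  qed
  show "M = L"
  proof (rule fls_eqI)
    fix n
    let ?p = "map_poly of_rat (fls_nth M n) :: real poly"
    let ?q = "map_poly of_rat (fls_nth L n) :: real poly"
    have "poly (?p - ?q) t = 0" if "0 \<le> t" for t
      using arg_cong[OF at[OF that], of "\<lambda>F. fls_nth F n"] by (simp add: poly_at_def)
    \<comment> \<open>The difference of the two coefficients vanishes on a half-line, which is too
      many roots for a nonzero polynomial.\<close>
    then have "{0..} \<subseteq> {t. poly (?p - ?q) t = 0}" by auto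
    then have "infinite {t. poly (?p - ?q) t = 0}"
      using infinite_Ici infinite_super by blast
    then have "?p - ?q = 0" using poly_roots_finite by blast
    then have "?p = ?q" by simp
    then show "fls_nth M n = fls_nth L n"
      by (auto simp: poly_eq_iff coeff_map_poly)
  qed
qed

section \<open>Sums over increasing tuples\<close>

text \<open>Prefixing \<open>n\<close> puts the lower bound and monotonicity into one condition;
  \<open>n = 0\<close> expresses positivity of the entries.\<close>

definition tails :: "nat \<Rightarrow> nat \<Rightarrow> nat list set" where
  "tails n r = {is. length is = r \<and> sorted_wrt (<) (n # is)}"

lemma tuples_eq_tails: "tuples k = tails 0 k"
  by (auto simp: tuples_def tails_def)

lemma tails_0 [simp]: "tails n 0 = {[]}"
  by (auto simp: tails_def)

lemma bij_betw_tails_Suc: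
  "bij_betw (\<lambda>(i, is). i # is) (SIGMA i:{n<..}. tails i r) (tails n (Suc r))"
proof (rule bij_betwI')
  fix y assume "y \<in> tails n (Suc r)"
  then show "\<exists>x\<in>SIGMA i:{n<..}. tails i r. y = (case x of (i, is) \<Rightarrow> i # is)"
    by (cases y) (auto simp: tails_def)
qed (auto simp: tails_def)

text \<open>Polymorphic because the real instance supplies the norms of the complex one.\<close>

definition exp_term :: "real \<Rightarrow> 'a::{real_normed_field,banach} \<Rightarrow> nat list \<Rightarrow> nat list \<Rightarrow> 'a" where
  "exp_term t z b is = (\<Prod>j<length b. exp (of_real ((real (is ! j) + t) * real (b ! j)) * z))"

lemma exp_term_Nil [simp]: "exp_term t z [] is = 1"
  by (simp add: exp_term_def)

lemma exp_term_Cons [simp]: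
  "exp_term t z (b # w) (i # is) = exp (of_real ((real i + t) * real b) * z) * exp_term t z w is"
  unfolding exp_term_def by (simp add: prod.lessThan_Suc_shift del: prod.lessThan_Suc)

text \<open>The analytic counterpart of \<open>geom_word\<close>, as \<open>tail_value\<close> is of
  \<open>Phi\<close>.\<close>

fun geom_prod :: "'a::{real_normed_field,banach} \<Rightarrow> nat list \<Rightarrow> 'a" where
  "geom_prod z [] = 1"
| "geom_prod z (b # w)
     = exp (of_nat (b + sum_list w) * z) / (1 - exp (of_nat (b + sum_list w) * z)) * geom_prod z w"

abbreviation tail_value :: "real \<Rightarrow> 'a::{real_normed_field,banach} \<Rightarrow> nat \<Rightarrow> nat list \<Rightarrow> 'a" where
  "tail_value t z n b \<equiv> exp (of_real ((real n + t) * real (sum_list b)) * z) * geom_prod z b"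

lemma has_sum_inner:
  fixes z :: "'a::{real_normed_field,banach}"
  assumes "(exp_term t z w has_sum tail_value t z i w) (tails i (length w))"
  shows "((\<lambda>is. exp_term t z (b # w) (i # is)) has_sum
      exp (of_real ((real i + t) * real (b + sum_list w)) * z) * geom_prod z w) (tails i (length w))"
proof -
  have "exp (of_real ((real i + t) * real (b + sum_list w)) * z) * geom_prod z w
      = exp (of_real ((real i + t) * real b) * z) * tail_value t z i w"
    by (simp only: exp_add of_nat_add of_real_add distrib_left distrib_right mult.assoc)
  then show ?thesis
    using has_sum_cmult_right[OF assms, of "exp (of_real ((real i + t) * real b) * z)"]
    by (simp only: exp_term_Cons)
qed

lemma has_sum_outer:
  fixes z :: "'a::{real_normed_field,banach}"
  assumes "norm (exp (of_nat B * z)) < 1"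
  shows "((\<lambda>i. exp (of_real ((real i + t) * real B) * z) * c) has_sum
      exp (of_real ((real n + t) * real B) * z)
        * (exp (of_nat B * z) / (1 - exp (of_nat B * z)) * c)) {n<..}"
proof -
  let ?q = "exp (of_nat B * z)" and ?e = "exp (of_real ((real n + t) * real B) * z)"
  have bij: "bij_betw (\<lambda>k. n + k) {1..} {n<..}"
    by (rule bij_betwI[where g = "\<lambda>i. i - n"]) auto
  have "((\<lambda>k. ?e * (?q ^ k * c)) has_sum ?e * (?q / (1 - ?q) * c)) {1..}"
    by (intro has_sum_cmult_right has_sum_cmult_left has_sum_geometric_from_1 assms)
  also have "(\<lambda>k. ?e * (?q ^ k * c)) = (\<lambda>k. exp (of_real ((real (n + k) + t) * real B) * z) * c)"
  proof
    fix k
    have "?e * ?q ^ k = exp (of_real ((real (n + k) + t) * real B) * z)"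
      by (simp add: algebra_simps flip: exp_add exp_of_nat_mult)
    then show "?e * (?q ^ k * c) = exp (of_real ((real (n + k) + t) * real B) * z) * c"
      by (simp flip: mult.assoc)
  qed
  finally show ?thesis
    by (subst (asm) has_sum_reindex_bij_betw[OF bij])
qed

lemma has_sum_exp_term_real:
  fixes z :: real
  assumes "z < 0" "\<forall>y\<in>set b. 0 < y"
  shows "(exp_term t z b has_sum tail_value t z n b) (tails n (length b))"
  using assms(2)
proof (induction b arbitrary: n)
  case Nil
  show ?case by (simp add: has_sum_finiteI)
next
  case (Cons b w)
  let ?g = "\<lambda>i. exp (of_real ((real i + t) * real (b + sum_list w)) * z) * geom_prod z w"
  have inner: "((\<lambda>is. exp_term t z (b # w) (i # is)) has_sum ?g i) (tails i (length w))" for i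
    using Cons by (intro has_sum_inner) auto
  have "0 < b + sum_list w" using Cons.prems by simp
  then have "real (b + sum_list w) * z < 0"
    using assms(1) by (intro mult_pos_neg) (simp only: of_nat_0_less_iff)
  then have "norm (exp (of_nat (b + sum_list w) * z)) < 1"
    by (simp del: of_nat_add)
  from has_sum_outer[OF this]
  have outer: "(?g has_sum tail_value t z n (b # w)) {n<..}"
    by simp
  have "(\<lambda>(i, is). exp_term t z (b # w) (i # is)) summable_on (SIGMA i:{n<..}. tails i (length w))"
  proof (rule summable_on_SigmaI)
    show "?g summable_on {n<..}" using outer by (rule has_sum_imp_summable)
    show "0 \<le> (case (i, is) of (i, is) \<Rightarrow> exp_term t z (b # w) (i # is))" for i "is"
      unfolding exp_term_def prod.case by (intro prod_nonneg) simp
  qed (use inner in simp)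
  with inner outer
  have "((\<lambda>(i, is). exp_term t z (b # w) (i # is)) has_sum tail_value t z n (b # w))
      (SIGMA i:{n<..}. tails i (length w))"
    by (intro has_sum_SigmaI[where g = ?g]) auto
  then show ?case
    using has_sum_reindex_bij_betw[OF bij_betw_tails_Suc, of "exp_term t z (b # w)"]
    by (simp add: case_prod_unfold)
qed

lemma has_sum_exp_term:
  fixes z :: complex
  assumes "Re z < 0" "\<forall>y\<in>set b. 0 < y"
  shows "(exp_term t z b has_sum tail_value t z n b) (tails n (length b))"
  using assms(2)
proof (induction b arbitrary: n)
  case Nil
  show ?case by (simp add: has_sum_finiteI)
next
  case (Cons b w)
  let ?g = "\<lambda>i. exp (of_real ((real i + t) * real (b + sum_list w)) * z) * geom_prod z w"
  have inner: "((\<lambda>is. exp_term t z (b # w) (i # is)) has_sum ?g i) (tails i (length w))" for i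
    using Cons by (intro has_sum_inner) auto
  have "0 < b + sum_list w" using Cons.prems by simp
  then have "real (b + sum_list w) * Re z < 0"
    using assms(1) by (intro mult_pos_neg) (simp only: of_nat_0_less_iff)
  then have "norm (exp (of_nat (b + sum_list w) * z)) < 1"
    by (simp del: of_nat_add)
  from has_sum_outer[OF this]
  have outer: "(?g has_sum tail_value t z n (b # w)) {n<..}"
    by simp
  have "norm (exp_term t z (b # w) is) = exp_term t (Re z) (b # w) is" for "is"
    unfolding exp_term_def prod_norm[symmetric] by (intro prod.cong refl) simp
  then have "(\<lambda>is. norm (exp_term t z (b # w) is)) summable_on tails n (Suc (length w))"
    using has_sum_exp_term_real[OF assms(1) Cons.prems] has_sum_imp_summable by fastforce
  then have "exp_term t z (b # w) summable_on tails n (Suc (length w))"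
    by (rule abs_summable_summable)
  then have "(\<lambda>(i, is). exp_term t z (b # w) (i # is)) summable_on (SIGMA i:{n<..}. tails i (length w))"
    using summable_on_reindex_bij_betw[OF bij_betw_tails_Suc, of "exp_term t z (b # w)"]
    by (simp add: case_prod_unfold)
  with inner outer
  have "((\<lambda>(i, is). exp_term t z (b # w) (i # is)) has_sum tail_value t z n (b # w))
      (SIGMA i:{n<..}. tails i (length w))"
    by (intro has_sum_SigmaI[where g = ?g]) auto
  then show ?case
    using has_sum_reindex_bij_betw[OF bij_betw_tails_Suc, of "exp_term t z (b # w)"]
    by (simp add: case_prod_unfold)
qed

lemma has_laurent_expansion_Phi:
  assumes "\<forall>y\<in>set b. 0 < y"
  shows "(\<lambda>z. tail_value t z n b) has_laurent_expansion fls_at (Phi n b) t"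
proof -
  have "(\<lambda>z. geom_prod z b) has_laurent_expansion fls_at (geom_word b) t"
    using assms
  proof (induction b)
    case Nil
    show ?case by simp
  next
    case (Cons b w)
    then show ?case
      unfolding geom_prod.simps geom_word.simps fls_at_mult
      by (intro has_laurent_expansion_mult has_laurent_expansion_geom) auto
  qed
  moreover have "(\<lambda>z. exp (of_real ((real n + t) * real (sum_list b)) * z))
      has_laurent_expansion fls_at (flexp (of_nat (sum_list b) * [:of_nat n, 1:])) t"
    using has_laurent_expansion_flexp[of t "of_nat (sum_list b) * [:of_nat n, 1:]"]
    by (simp add: mult.commute del: mult_pCons_right mult_pCons_left)
  ultimately show ?thesis
    unfolding Phi_def fls_at_mult by (intro has_laurent_expansion_mult)
qed

section \<open>Splitting off the trailing zeros\<close>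

definition fibre :: "nat list \<Rightarrow> mon \<Rightarrow> nat list set" where
  "fibre a m = {is \<in> tuples (length a). tmon a is = m}"

lemma sorted_wrt_less_append:
  fixes xs ys :: "nat list"
  assumes "xs \<noteq> []"
  shows "sorted_wrt (<) (xs @ ys) \<longleftrightarrow> sorted_wrt (<) xs \<and> sorted_wrt (<) (last xs # ys)"
proof -
  obtain us x where "xs = us @ [x]" using assms by (metis rev_exhaust)
  then show ?thesis
    by (auto simp: sorted_wrt_append intro: less_trans)
qed

lemma tmon_append_zeros:
  assumes "length is = length a"
  shows "tmon (a @ replicate r 0) (is @ js) = tmon a is"
proof -
  have "tmon (a @ replicate r 0) (is @ js)
      = (\<Sum>j<length a. Poly_Mapping.single ((is @ js) ! j) ((a @ replicate r 0) ! j))"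
    unfolding tmon_def by (rule sum.mono_neutral_right) (auto simp: nth_append)
  also have "\<dots> = tmon a is"
    unfolding tmon_def by (rule sum.cong) (use assms in \<open>auto simp: nth_append\<close>)
  finally show ?thesis .
qed

lemma fibre_append_zeros:
  "fibre (a @ replicate r 0) m = (\<Union>is\<in>fibre a m. (@) is ` tails (last (0 # is)) r)"
proof (intro equalityI subsetI)
  fix x assume x: "x \<in> fibre (a @ replicate r 0) m"
  define i j where "i = take (length a) x" and "j = drop (length a) x"
  have xij: "x = i @ j" by (simp add: i_def j_def)
  have len: "length i = length a" "length j = r"
    using x by (auto simp: fibre_def tuples_def i_def j_def)
  have "sorted_wrt (<) ((0 # i) @ j)"
    using x by (simp add: fibre_def tuples_eq_tails tails_def xij)
  then have "sorted_wrt (<) (0 # i)" "sorted_wrt (<) (last (0 # i) # j)"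
    using sorted_wrt_less_append[of "0 # i" j] by blast+
  then have "i \<in> fibre a m" "j \<in> tails (last (0 # i)) r"
    using x len tmon_append_zeros[of i a r j] by (auto simp: fibre_def tuples_eq_tails tails_def xij)
  then show "x \<in> (\<Union>is\<in>fibre a m. (@) is ` tails (last (0 # is)) r)"
    by (auto simp: xij simp del: last.simps)
next
  fix x assume "x \<in> (\<Union>is\<in>fibre a m. (@) is ` tails (last (0 # is)) r)"
  then obtain i j where ij: "x = i @ j" "i \<in> fibre a m" "j \<in> tails (last (0 # i)) r" by blast
  then have "length i = length a" "length j = r" "sorted_wrt (<) (0 # i)"
      "sorted_wrt (<) (last (0 # i) # j)" "tmon a i = m"
    by (simp_all add: fibre_def tuples_eq_tails tails_def)
  then show "x \<in> fibre (a @ replicate r 0) m"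
    using sorted_wrt_less_append[of "0 # i" j] tmon_append_zeros[of i a r j]
    by (simp add: fibre_def tuples_eq_tails tails_def ij)
qed

lemma fibre_Nil: "fibre [] m = (if m = 0 then {[]} else {})"
  by (auto simp: fibre_def tuples_def tmon_def)

lemma finite_fibre:
  assumes "a = [] \<or> 0 < last a"
  shows "finite (fibre a m)"
proof (cases "a = []")
  case True
  then show ?thesis by (simp add: fibre_Nil)
next
  case False
  then have pos: "0 < last a" using assms by simp
  have "fibre a m \<subseteq> {is. set is \<subseteq> {..Max (Poly_Mapping.keys m)} \<and> length is = length a}"
  proof
    fix x assume "x \<in> fibre a m"
    then have x: "length x = length a" "sorted_wrt (<) x" "tmon a x = m"
      by (auto simp: fibre_def tuples_def)
    then have "x \<noteq> []" using False by auto
    have "last a \<le> Poly_Mapping.lookup (tmon a x) (last x)"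
    proof -
      let ?l = "length a - 1"
      have "Poly_Mapping.lookup (tmon a x) (last x)
          = (\<Sum>j<length a. Poly_Mapping.lookup (Poly_Mapping.single (x ! j) (a ! j)) (last x))"
        by (simp add: tmon_def lookup_sum)
      also have "\<dots> \<ge> (\<Sum>j\<in>{?l}. Poly_Mapping.lookup (Poly_Mapping.single (x ! j) (a ! j)) (last x))"
        using False by (intro sum_mono2) auto
      finally show ?thesis
        using False \<open>x \<noteq> []\<close> x by (simp add: last_conv_nth)
    qed
    then have "last x \<in> Poly_Mapping.keys m" using pos x(3) by (simp add: in_keys_iff)
    then have last: "last x \<le> Max (Poly_Mapping.keys m)" by simp
    have "y \<le> last x" if "y \<in> set x" for y
    proof -
      have "x = butlast x @ [last x]" using \<open>x \<noteq> []\<close> by simp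
      then have "sorted_wrt (<) (butlast x @ [last x])" "y \<in> set (butlast x @ [last x])"
        using x(2) that by simp_all
      then show ?thesis by (auto simp: sorted_wrt_append)
    qed
    then show "x \<in> {is. set is \<subseteq> {..Max (Poly_Mapping.keys m)} \<and> length is = length a}"
      using last x(1) by fastforce
  qed
  then show ?thesis
    by (rule finite_subset) (intro finite_lists_length_eq finite_atMost)
qed

definition head_exp :: "nat list \<Rightarrow> nat list \<Rightarrow> rat poly fls" where
  "head_exp b is = flexp (\<Sum>j<length b. of_nat (b ! j) * [:of_nat (is ! j), 1:])"

lemma head_exp_Nil [simp]: "head_exp [] is = 1"
  by (simp add: head_exp_def)

lemma has_laurent_expansion_head_exp:
  "(\<lambda>z. exp_term t z b is) has_laurent_expansion fls_at (head_exp b is) t"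
proof -
  let ?x = "\<Sum>j<length b. of_nat (b ! j) * [:of_nat (is ! j), 1:] :: rat poly"
  have *: "poly_at t ?x = (\<Sum>j<length b. complex_of_real ((real (is ! j) + t) * real (b ! j)))"
    by (simp add: mult.commute del: mult_pCons_left mult_pCons_right)
  have "exp (poly_at t ?x * z) = exp_term t z b is" for z
    unfolding exp_term_def * sum_distrib_right by (rule exp_sum) simp
  then show ?thesis
    using has_laurent_expansion_flexp[of t ?x] by (simp add: head_exp_def)
qed

lemma prod_lessThan_add: "(\<Prod>j<k + r. f j) = (\<Prod>j<k. f j) * (\<Prod>j<r. f (k + j))"
  for f :: "nat \<Rightarrow> 'a::comm_monoid_mult"
  by (induction r) (simp_all add: mult.assoc)

lemma exp_term_append:
  assumes "length is = length b"
  shows "exp_term t z (b @ c) (is @ js) = exp_term t z b is * exp_term t z c js"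
  using assms by (simp add: exp_term_def prod_lessThan_add nth_append)

lemma phi_append_zeros:
  assumes a: "a = [] \<or> 0 < last a" and b: "length b = length a" and c: "\<forall>y\<in>set c. 0 < y"
  shows "phi (a @ replicate (length c) 0) (b @ c) m
      = (\<Sum>is\<in>fibre a m. head_exp b is * Phi (last (0 # is)) c)"
proof (rule phi_eqI, intro exI conjI allI impI)
  fix t :: real
  let ?f = "\<lambda>z. \<Sum>is\<in>fibre a m. exp_term t z b is * tail_value t z (last (0 # is)) c"
  show "?f has_laurent_expansion fls_at (\<Sum>is\<in>fibre a m. head_exp b is * Phi (last (0 # is)) c) t"
    unfolding fls_at_sum fls_at_mult
    by (intro has_laurent_expansion_sum has_laurent_expansion_mult has_laurent_expansion_head_exp
        has_laurent_expansion_Phi c)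
  fix z :: complex assume z: "Re z < 0"
  have "(exp_term t z (b @ c) has_sum ?f z) (\<Union>is\<in>fibre a m. (@) is ` tails (last (0 # is)) (length c))"
  proof (rule sum_has_sum)
    show "finite (fibre a m)" using a by (rule finite_fibre)
  next
    fix i assume i: "i \<in> fibre a m"
    then have "length i = length b" using b by (simp add: fibre_def tuples_def)
    then have "exp_term t z (b @ c) \<circ> (@) i = (\<lambda>js. exp_term t z b i * exp_term t z c js)"
      by (simp add: fun_eq_iff exp_term_append)
    then show "(exp_term t z (b @ c) has_sum exp_term t z b i * tail_value t z (last (0 # i)) c)
        ((@) i ` tails (last (0 # i)) (length c))"
      using has_sum_cmult_right[OF has_sum_exp_term[OF z c]]
      by (subst has_sum_reindex) (simp_all add: inj_on_def del: last.simps)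
  next
    fix i i' assume "i \<in> fibre a m" "i' \<in> fibre a m" "i \<noteq> i'"
    then show "(@) i ` tails (last (0 # i)) (length c) \<inter> (@) i' ` tails (last (0 # i')) (length c) = {}"
      by (auto simp: fibre_def tuples_def simp del: last.simps)
  qed
  then have "(exp_term t z (b @ c) has_sum ?f z) (fibre (a @ replicate (length c) 0) m)"
    by (simp only: fibre_append_zeros)
  then show "?f z = Scoef (a @ replicate (length c) 0) (b @ c) m t z"
    unfolding Scoef_def fibre_def[symmetric]
    using infsumI b by (fastforce simp: exp_term_def[abs_def])
qed

section \<open>Renormalisation\<close>

lemma finite_mon_splits: "finite {(u, v). u + v = (m :: mon)}"
proof -
  define U where "U = {u :: mon. \<exists>v. u + v = m}"
  have le: "Poly_Mapping.lookup u i \<le> Poly_Mapping.lookup m i" if "u \<in> U" for u i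
    using that by (auto simp: U_def lookup_add)
  have inj: "inj_on (\<lambda>u. restrict (Poly_Mapping.lookup u) (Poly_Mapping.keys m)) U"
  proof (rule inj_onI)
    fix u v assume uv: "u \<in> U" "v \<in> U" "restrict (Poly_Mapping.lookup u) (Poly_Mapping.keys m) = restrict (Poly_Mapping.lookup v) (Poly_Mapping.keys m)"
    have "Poly_Mapping.lookup u i = Poly_Mapping.lookup v i" for i
    proof (cases "i \<in> Poly_Mapping.keys m")
      case True
      then show ?thesis using fun_cong[OF uv(3), of i] by simp
    next
      case False
      then show ?thesis using le[OF uv(1), of i] le[OF uv(2), of i] by (simp add: in_keys_iff)
    qed
    then show "u = v" by (intro poly_mapping_eqI)
  qed
  have "(\<lambda>u. restrict (Poly_Mapping.lookup u) (Poly_Mapping.keys m)) ` U \<subseteq> PiE (Poly_Mapping.keys m) (\<lambda>i. {..Poly_Mapping.lookup m i})"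
    using le by auto
  then have "finite ((\<lambda>u. restrict (Poly_Mapping.lookup u) (Poly_Mapping.keys m)) ` U)"
    by (rule finite_subset) (intro finite_PiE finite_keys finite_atMost)
  then have "finite U" using inj by (rule finite_imageD)
  moreover have "{(u, v). u + v = m} \<subseteq> U \<times> U"
    by (auto simp: U_def) (metis add.commute)
  ultimately show ?thesis by (meson finite_SigmaI finite_subset)
qed

lemma xmul_supported_at_0:
  assumes "\<And>v. v \<noteq> 0 \<Longrightarrow> g v = 0"
  shows "xmul f g m = f m * g 0"
proof -
  have "xmul f g m = (\<Sum>p\<in>{(m, 0)}. f (fst p) * g (snd p))"
    unfolding xmul_def
  proof (rule sum.mono_neutral_right[OF finite_mon_splits])
    show "\<forall>p\<in>{(u, v). u + v = m} - {(m, 0)}. f (fst p) * g (snd p) = 0"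
    proof
      fix p assume "p \<in> {(u, v). u + v = m} - {(m, 0)}"
      then have "snd p \<noteq> 0" by auto
      then show "f (fst p) * g (snd p) = 0" by (simp add: assms)
    qed
  qed simp
  then show ?thesis by simp
qed

declare phim.simps [simp del]

definition prepared :: "nat list \<Rightarrow> nat list \<Rightarrow> mon \<Rightarrow> rat poly fls" where
  "prepared a b m = phi a b m + (\<Sum>i\<in>{1..<length a}.
     xmul (phi (take i a) (take i b)) (phim (drop i a) (drop i b)) m)"

lemma phim_eq_polar: "a \<noteq> [] \<Longrightarrow> phim a b m = - polar (prepared a b m)"
  by (subst phim.simps) (simp add: prepared_def)

lemma phip_eq: "phip a b m = prepared a b m - polar (prepared a b m)"
  by (simp add: phip_def prepared_def)

lemma phi_zeros:
  assumes "\<forall>y\<in>set b. 0 < y"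
  shows "phi (replicate (length b) 0) b m = (if m = 0 then Phi 0 b else 0)"
  using phi_append_zeros[of "[]" "[]" b m] assms by (simp add: fibre_Nil)

lemma phim_zeros_eq_0:
  assumes "\<forall>y\<in>set b. 0 < y" "m \<noteq> 0"
  shows "phim (replicate (length b) 0) b m = 0"
  using assms
proof (induction b arbitrary: m rule: length_induct)
  case (1 b)
  show ?case
  proof (cases "b = []")
    case True
    then show ?thesis using 1 by (simp add: phim.simps)
  next
    case False
    have "xmul (phi (take i (replicate (length b) 0)) (take i b))
        (phim (drop i (replicate (length b) 0)) (drop i b)) m = 0" if i: "i \<in> {1..<length b}" for i
    proof -
      have "phim (replicate (length (drop i b)) 0) (drop i b) v = 0" if "v \<noteq> 0" for v
        using i that False "1.prems"(1)
        by (intro "1.IH"[rule_format]) (auto dest: in_set_dropD)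
      moreover have "phi (replicate (length (take i b)) 0) (take i b) m = 0"
        using 1 by (subst phi_zeros) (auto dest: in_set_takeD)
      ultimately show ?thesis
        by (subst xmul_supported_at_0) (simp_all add: min.commute)
    qed
    moreover have "phi (replicate (length b) 0) b m = 0"
      using 1 by (subst phi_zeros) auto
    ultimately have "prepared (replicate (length b) 0) b m = 0"
      by (simp add: prepared_def)
    moreover have "polar 0 = (0 :: rat poly fls)"
      by (simp add: polar_eq_0_iff regular_def)
    ultimately show ?thesis
      using False by (subst phim_eq_polar) simp_all
  qed
qed

definition mu :: "nat list \<Rightarrow> rat poly fls" where
  "mu b = phim (replicate (length b) 0) b 0"

definition renorm :: "nat \<Rightarrow> nat list \<Rightarrow> rat poly fls" where
  "renorm n = conv (Phi n) mu"

lemma mu_Nil [simp]: "mu [] = 1"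
  by (simp add: mu_def phim.simps)

lemma renorm_Nil [simp]: "renorm n [] = 1"
  by (simp add: renorm_def)

lemma renorm_letter: "renorm n [c] = Phi n [c] + mu [c]"
  by (simp add: renorm_def)

lemma xmul_phim_zeros:
  assumes "\<forall>y\<in>set c. 0 < y"
  shows "xmul f (phim (replicate (length c) 0) c) m = f m * mu c"
  using xmul_supported_at_0[of "phim (replicate (length c) 0) c" f m] phim_zeros_eq_0[OF assms]
  by (simp add: mu_def)

lemma prepared_zeros:
  assumes "\<forall>y\<in>set b. 0 < y" "b \<noteq> []"
  shows "prepared (replicate (length b) 0) b m = (if m = 0 then renorm 0 b - mu b else 0)"
proof -
  have "xmul (phi (take i (replicate (length b) 0)) (take i b))
      (phim (drop i (replicate (length b) 0)) (drop i b)) m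
      = (if m = 0 then Phi 0 (take i b) * mu (drop i b) else 0)" if i: "i \<in> {1..<length b}" for i
  proof -
    have pos: "\<forall>y\<in>set (drop i b). 0 < y" "\<forall>y\<in>set (take i b). 0 < y"
      using assms by (auto dest: in_set_takeD in_set_dropD)
    show ?thesis
      using xmul_phim_zeros[OF pos(1), of "phi (take i (replicate (length b) 0)) (take i b)" m]
        phi_zeros[OF pos(2), of m] i
      by (simp add: min_absorb1)
  qed
  moreover have "renorm 0 b = mu b + (\<Sum>i\<in>{1..<length b}. Phi 0 (take i b) * mu (drop i b)) + Phi 0 b"
  proof -
    have "{..length b} = insert 0 (insert (length b) {1..<length b})" by auto
    then show ?thesis using assms(2) by (simp add: renorm_def conv_conv_sum)
  qed
  ultimately show ?thesis
    using phi_zeros[OF assms(1), of m] by (simp add: prepared_def)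
qed

lemma mu_eq_polar:
  assumes "\<forall>y\<in>set b. 0 < y" "b \<noteq> []"
  shows "mu b = - polar (renorm 0 b - mu b)"
  unfolding mu_def[of b] using assms by (subst phim_eq_polar) (simp_all add: prepared_zeros mu_def)

lemma mu_nth_nonneg:
  assumes "\<forall>y\<in>set b. 0 < y" "b \<noteq> []"
  shows "\<forall>n\<ge>0. fls_nth (mu b) n = 0"
  by (subst mu_eq_polar[OF assms]) (simp add: nth_polar)

lemma regular_1: "regular (1 :: 'a::comm_ring_1 fls)"
  by (simp add: regular_def)

lemma regular_renorm_0:
  assumes "\<forall>y\<in>set b. 0 < y"
  shows "regular (renorm 0 b)"
proof (cases "b = []")
  case False
  have "renorm 0 b = (renorm 0 b - mu b) - polar (renorm 0 b - mu b)"
    using mu_eq_polar[OF assms False] by simp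
  then show ?thesis using regular_diff_polar by metis
qed (simp add: regular_1)

lemma regular_sum_list: "(\<And>x. x \<in> set xs \<Longrightarrow> regular (F x)) \<Longrightarrow> regular (sum_list (map F xs))"
  for F :: "'b \<Rightarrow> 'a::ab_group_add fls"
  by (induction xs) (auto intro: regular_add simp: regular_def)

lemma fls_nth_sum_list: "fls_nth (sum_list (map F xs)) n = sum_list (map (\<lambda>x. fls_nth (F x) n) xs)"
  for F :: "'b \<Rightarrow> 'a::comm_monoid_add fls"
  by (induction xs) simp_all

lemma conv_cong_proper_suffix:
  assumes "\<And>u v. w = u @ v \<Longrightarrow> u \<noteq> [] \<Longrightarrow> g v = g' v"
  shows "conv f g w - f [] * g w = conv f g' w - f [] * g' w"
proof (cases w)
  case (Cons b w')
  have "conv (\<lambda>u. f (b # u)) g w' = conv (\<lambda>u. f (b # u)) g' w'"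
    using assms Cons by (intro conv_cong) (metis append_Cons list.distinct(1))
  then show ?thesis by (simp add: Cons)
qed simp

text \<open>The defects of multiplicativity of \<open>renorm 0\<close> and of \<open>mu\<close> coincide; the first is regular and
  the second is polar, so both vanish.\<close>
lemma mu_stuffle:
  assumes c: "0 < c" and "\<forall>y\<in>set w. 0 < y"
  shows "stuffle_sum mu c w = mu [c] * mu w"
  using assms(2)
proof (induction w rule: length_induct)
  case (1 w)
  note pos = "1.prems"
  show ?case
  proof (cases "w = []")
    case False
    let ?D = "stuffle_sum mu c w - mu [c] * mu w"
    have "conv (stuffle_sum (Phi 0) c) mu w = conv (\<lambda>u. Phi 0 [c] * Phi 0 u) mu w"
      using pos by (intro conv_cong) (simp add: Phi_stuffle[OF c])
    then have l: "conv (stuffle_sum (Phi 0) c) mu w = Phi 0 [c] * renorm 0 w"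
      by (simp add: renorm_def conv_cmult_left)
    have "conv (Phi 0) (stuffle_sum mu c) w - Phi 0 [] * stuffle_sum mu c w
        = conv (Phi 0) (\<lambda>v. mu [c] * mu v) w - Phi 0 [] * (mu [c] * mu w)"
      using 1 by (intro conv_cong_proper_suffix) simp
    then have r: "conv (Phi 0) (stuffle_sum mu c) w = mu [c] * renorm 0 w + ?D"
      by (simp only: conv_cmult_right Phi_Nil) (simp add: renorm_def algebra_simps)
    have D: "stuffle_sum (renorm 0) c w - renorm 0 [c] * renorm 0 w = ?D"
      unfolding renorm_letter unfolding renorm_def stuffle_sum_conv
      using l r by (simp add: renorm_def algebra_simps)
    have "regular (stuffle_sum (renorm 0) c w - renorm 0 [c] * renorm 0 w)"
      using c pos stuffle1_pos(1)
      by (intro regular_diff regular_sum_list regular_mult(1) regular_renorm_0) auto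
    then have "\<forall>n<0. fls_nth ?D n = 0"
      unfolding D by (simp only: regular_def)
    moreover have "\<forall>n\<ge>0. fls_nth ?D n = 0"
    proof -
      have "\<forall>n\<ge>0. fls_nth (stuffle_sum mu c w) n = 0"
        using mu_nth_nonneg stuffle1_pos[OF _ c pos]
        by (auto simp: fls_nth_sum_list intro!: sum_list_0 cong: map_cong)
      moreover have "\<forall>n\<ge>0. fls_nth (mu [c] * mu w) n = 0"
        using c pos False by (intro polar_times_polar mu_nth_nonneg) auto
      ultimately show ?thesis by simp
    qed
    ultimately have "?D = 0" by (metis fls_eqI fls_zero_nth linorder_not_less)
    then show ?thesis by simp
  qed simp
qed

lemma renorm_stuffle:
  assumes c: "0 < c" and w: "\<forall>y\<in>set w. 0 < y"
  shows "stuffle_sum (renorm n) c w = renorm n [c] * renorm n w"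
proof -
  have "conv (stuffle_sum (Phi n) c) mu w = conv (\<lambda>u. Phi n [c] * Phi n u) mu w"
    using w by (intro conv_cong) (simp add: Phi_stuffle[OF c])
  moreover have "conv (Phi n) (stuffle_sum mu c) w = conv (Phi n) (\<lambda>v. mu [c] * mu v) w"
    using w by (intro conv_cong) (simp add: mu_stuffle[OF c])
  ultimately show ?thesis
    unfolding renorm_letter unfolding renorm_def stuffle_sum_conv
    by (simp only: conv_cmult_left conv_cmult_right distrib_right)
qed

lemma renorm_Cons:
  assumes "0 < b"
  shows "renorm n (b # w) = renorm (Suc n) (b # w)
      + flexp (of_nat b * [:of_nat (Suc n), 1:]) * renorm (Suc n) w"
proof -
  have "conv (\<lambda>u. Phi n (b # u)) mu w = conv (\<lambda>u. Phi (Suc n) (b # u)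
      + flexp (of_nat b * [:of_nat (Suc n), 1:]) * Phi (Suc n) u) mu w"
    by (rule arg_cong[of _ _ "\<lambda>f. conv f mu w"]) (rule ext, rule Phi_Cons[OF assms])
  then show ?thesis
    by (simp add: renorm_def conv_add_left conv_cmult_left del: mult_pCons_right mult_pCons_left of_nat_Suc)
qed

lemma regular_renorm:
  assumes "\<forall>y\<in>set b. 0 < y"
  shows "regular (renorm n b)"
  using assms
proof (induction n arbitrary: b)
  case 0
  then show ?case by (rule regular_renorm_0)
next
  case (Suc n)
  from Suc.prems show ?case
  proof (induction b)
    case Nil
    show ?case by (simp add: regular_1)
  next
    case (Cons b w)
    have "renorm (Suc n) (b # w)
        = renorm n (b # w) - flexp (of_nat b * [:of_nat (Suc n), 1:]) * renorm (Suc n) w"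
      using renorm_Cons[of b n w] Cons.prems by simp
    then show ?case
      using Suc.IH[of "b # w"] Cons by (auto intro: regular_diff regular_mult(1) regular_flexp)
  qed
qed

definition rho :: "nat \<Rightarrow> nat list \<Rightarrow> rat poly" where
  "rho n b = fls_nth (renorm n b) 0"

lemma rho_symmetrised:
  assumes "finite A" "\<forall>x\<in>A. 0 < h x"
  shows "(\<Sum>xs\<in>permutations_of_set A. rho n (map h xs))
      = (\<Prod>i<card A. [:- of_nat n - 1 / 2, - 1:] - of_nat i)"
proof (rule symmetrised_stuffle_character[OF _ _ _ assms])
  show "rho n [] = 1" by (simp add: rho_def)
next
  fix c :: nat assume "0 < c"
  then show "rho n [c] = [:- of_nat n - 1 / 2, - 1:]"
    using mu_nth_nonneg[of "[c]"] by (simp add: rho_def renorm_letter Phi_letter_const)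
next
  fix c :: nat and w :: "nat list" assume cw: "0 < c" "\<forall>y\<in>set w. 0 < y"
  then have "fls_nth (renorm n [c] * renorm n w) 0 = rho n [c] * rho n w"
    unfolding rho_def by (intro regular_mult(2) regular_renorm) auto
  then show "stuffle_sum (rho n) c w = rho n [c] * rho n w"
    unfolding renorm_stuffle[OF cw, symmetric] fls_nth_sum_list by (simp add: rho_def[abs_def])
qed

lemma prepared_append_zeros:
  assumes a: "a \<noteq> []" "0 < last a" and b: "length b = length a" and c: "\<forall>y\<in>set c. 0 < y"
    and van: "\<And>i m. 0 < i \<Longrightarrow> i < length a \<Longrightarrow>
      phim (drop i a @ replicate (length c) 0) (drop i b @ c) m = 0"
  shows "prepared (a @ replicate (length c) 0) (b @ c) m
      = (\<Sum>is\<in>fibre a m. head_exp b is * renorm (last (0 # is)) c)"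
proof -
  let ?k = "length a" and ?r = "length c"
  let ?x = "\<lambda>i. xmul (phi (take i (a @ replicate ?r 0)) (take i (b @ c)))
      (phim (drop i (a @ replicate ?r 0)) (drop i (b @ c))) m"
  have phi_c: "phi (a @ replicate (length d) 0) (b @ d) m
      = (\<Sum>is\<in>fibre a m. head_exp b is * Phi (last (0 # is)) d)" if "\<forall>y\<in>set d. 0 < y" for d
    using a b that by (intro phi_append_zeros) auto
  have 1: "?x i = 0" if "i \<in> {1..<?k}" for i
  proof -
    have "phim (drop i (a @ replicate ?r 0)) (drop i (b @ c)) = (\<lambda>m. 0)"
      using van[of i] that b by auto
    then show ?thesis by (simp add: xmul_def)
  qed
  have 2: "?x (j + ?k) = (\<Sum>is\<in>fibre a m. head_exp b is * (Phi (last (0 # is)) (take j c) * mu (drop j c)))"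
    if j: "j < ?r" for j
  proof -
    have pos: "\<forall>y\<in>set (drop j c). 0 < y" "\<forall>y\<in>set (take j c). 0 < y"
      using c by (auto dest: in_set_takeD in_set_dropD)
    have "?x (j + ?k) = phi (a @ replicate (length (take j c)) 0) (b @ take j c) m * mu (drop j c)"
      using xmul_phim_zeros[OF pos(1), of "phi (a @ replicate (length (take j c)) 0) (b @ take j c)" m] j b
      by (simp add: min_absorb1)
    then show ?thesis
      by (simp only: phi_c[OF pos(2)] sum_distrib_right mult.assoc)
  qed
  have "{1..<?k + ?r} = {1..<?k} \<union> {?k..<?k + ?r}" using a(1) by (cases a) auto
  then have "(\<Sum>i\<in>{1..<?k + ?r}. ?x i) = (\<Sum>i\<in>{1..<?k}. ?x i) + (\<Sum>i\<in>{?k..<?k + ?r}. ?x i)"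
    by (simp only:) (rule sum.union_disjoint; auto)
  also have "(\<Sum>i\<in>{?k..<?k + ?r}. ?x i) = (\<Sum>j<?r. ?x (j + ?k))"
    using sum.shift_bounds_nat_ivl[of ?x 0 ?k ?r] by (simp add: add.commute atLeast0LessThan)
  also have "\<dots> = (\<Sum>is\<in>fibre a m. \<Sum>j<?r. head_exp b is * (Phi (last (0 # is)) (take j c) * mu (drop j c)))"
    using 2 by (subst sum.swap) (rule sum.cong; simp)
  finally have "(\<Sum>i\<in>{1..<?k + ?r}. ?x i)
      = (\<Sum>is\<in>fibre a m. head_exp b is * (\<Sum>j<?r. Phi (last (0 # is)) (take j c) * mu (drop j c)))"
    using 1 by (simp add: sum_distrib_left)
  then have "prepared (a @ replicate ?r 0) (b @ c) m
      = (\<Sum>is\<in>fibre a m. head_exp b is * ((\<Sum>j<?r. Phi (last (0 # is)) (take j c) * mu (drop j c))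
            + Phi (last (0 # is)) c))"
    unfolding prepared_def length_append length_replicate phi_c[OF c]
    by (simp only: distrib_left sum.distrib add.commute)
  also have "\<dots> = (\<Sum>is\<in>fibre a m. head_exp b is * renorm (last (0 # is)) c)"
    by (simp add: renorm_def conv_conv_sum lessThan_Suc_atMost[symmetric] del: last.simps)
  finally show ?thesis .
qed

lemma regular_head_sum:
  assumes "\<forall>y\<in>set c. 0 < y"
  shows "regular (\<Sum>is\<in>A. head_exp b is * renorm (N is) c)"
    and "fls_nth (\<Sum>is\<in>A. head_exp b is * renorm (N is) c) 0 = (\<Sum>is\<in>A. rho (N is) c)"
  using regular_mult[OF regular_flexp regular_renorm[OF assms]]
  by (auto simp: head_exp_def fls_nth_sum rho_def flexp_nth_0 intro!: regular_sum)

lemma phim_append_zeros_eq_0: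
  assumes "a \<noteq> []" "0 < last a" "length b = length a" "\<forall>y\<in>set c. 0 < y"
  shows "phim (a @ replicate (length c) 0) (b @ c) m = 0"
  using assms
proof (induction a arbitrary: b m rule: length_induct)
  case (1 a)
  have "prepared (a @ replicate (length c) 0) (b @ c) m
      = (\<Sum>is\<in>fibre a m. head_exp b is * renorm (last (0 # is)) c)"
    using 1 by (intro prepared_append_zeros) auto
  moreover have "polar (\<Sum>is\<in>fibre a m. head_exp b is * renorm (last (0 # is)) c) = 0"
    unfolding polar_eq_0_iff using 1 by (intro regular_head_sum) auto
  ultimately show ?case
    using "1.prems" by (subst phim_eq_polar) auto
qed

lemma Zv_append_zeros:
  assumes a: "a = [] \<or> 0 < last a" and b: "length b = length a" and c: "\<forall>y\<in>set c. 0 < y"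
    and ne: "a \<noteq> [] \<or> c \<noteq> []"
  shows "Zv (a @ replicate (length c) 0) (b @ c) m = (\<Sum>is\<in>fibre a m. rho (last (0 # is)) c)"
proof (cases "a = []")
  case True
  then have "b = []" "c \<noteq> []" using b ne by auto
  have "fls_nth (mu c) 0 = 0" using mu_nth_nonneg[OF c \<open>c \<noteq> []\<close>] by simp
  then show ?thesis
    using True \<open>b = []\<close> \<open>c \<noteq> []\<close> prepared_zeros[OF c, of m]
    by (simp add: Zv_def phip_eq fibre_Nil nth_polar rho_def)
next
  case False
  have "prepared (a @ replicate (length c) 0) (b @ c) m
      = (\<Sum>is\<in>fibre a m. head_exp b is * renorm (last (0 # is)) c)"
    using False a b c by (intro prepared_append_zeros phim_append_zeros_eq_0) auto
  then show ?thesis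
    using regular_head_sum(2)[OF c, where N = "\<lambda>is. last (0 # is)" and b = b and A = "fibre a m"]
    by (simp add: Zv_def phip_eq nth_polar del: last.simps)
qed

lemma append_zeros_cases:
  obtains a' r where "a = a' @ replicate r (0 :: nat)" "a' = [] \<or> 0 < last a'"
proof -
  have "\<exists>a' r. a = a' @ replicate r 0 \<and> (a' = [] \<or> 0 < last a')"
  proof (induction a rule: rev_induct)
    case Nil
    show ?case by simp
  next
    case (snoc x xs)
    then obtain a' r where ar: "xs = a' @ replicate r 0" "a' = [] \<or> 0 < last a'" by blast
    show ?case
    proof (cases "x = 0")
      case True
      then have "xs @ [x] = a' @ replicate (Suc r) 0"
        by (simp add: ar(1) replicate_append_same)
      with ar(2) show ?thesis by blast
    next
      case False
      then have "xs @ [x] = (xs @ [x]) @ replicate 0 0" "0 < last (xs @ [x])" by simp_all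
      then show ?thesis by blast
    qed
  qed
  then show ?thesis using that by blast
qed

lemma lastpos_append_zeros:
  assumes "a = [] \<or> 0 < last a"
  shows "lastpos (a @ replicate r 0) = length a"
proof (cases "a = []")
  case False
  then have pos: "0 < last a" using assms by simp
  have "(GREATEST i. i < length (a @ replicate r 0) \<and> 0 < (a @ replicate r 0) ! i) = length a - 1"
  proof (rule Greatest_equality)
    fix y assume "y < length (a @ replicate r 0) \<and> 0 < (a @ replicate r 0) ! y"
    then show "y \<le> length a - 1" by (cases "y < length a") (auto simp: nth_append)
  qed (use pos False in \<open>auto simp: nth_append last_conv_nth trans_less_add1\<close>)
  moreover have "\<not> (\<forall>x\<in>set (a @ replicate r 0). x = 0)"
    using pos False last_in_set[of a] by (metis UnI1 less_irrefl set_append)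
  ultimately show ?thesis using False by (simp add: lastpos_def)
qed (simp add: lastpos_def)

lemma Zsym_append_zeros:
  assumes a: "a = [] \<or> 0 < last a" and b: "length b = length a" and c: "\<forall>y\<in>set c. 0 < y"
    and ne: "a \<noteq> [] \<or> c \<noteq> []"
  shows "Zsym (a @ replicate (length c) 0) (b @ c) m
     = (\<Sum>is\<in>fibre a m. \<Prod>i<length c. [:- of_nat (last (0 # is)) - 1 / 2, - 1:] - of_nat i)"
proof -
  let ?r = "length c"
  have Z: "Zv (a @ replicate ?r 0) (b @ map (\<lambda>i. c ! \<sigma> i) [0..<?r]) m
      = (\<Sum>is\<in>fibre a m. rho (last (0 # is)) (map ((!) c) (map \<sigma> [0..<?r])))"
    if "\<sigma> permutes {0..<?r}" for \<sigma>
  proof -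
    have "\<forall>y\<in>set (map (\<lambda>i. c ! \<sigma> i) [0..<?r]). 0 < y"
      using c permutes_in_image[OF that] by fastforce
    from Zv_append_zeros[OF a b this] ne show ?thesis
      by (simp add: o_def del: last.simps)
  qed
  have "Zsym (a @ replicate ?r 0) (b @ c) m
      = (\<Sum>\<sigma> | \<sigma> permutes {0..<?r}. Zv (a @ replicate ?r 0) (b @ map (\<lambda>i. c ! \<sigma> i) [0..<?r]) m)"
    using b by (simp add: Zsym_def Let_def lastpos_append_zeros[OF a])
  also have "\<dots> = (\<Sum>\<sigma> | \<sigma> permutes {0..<?r}. \<Sum>is\<in>fibre a m.
      rho (last (0 # is)) (map ((!) c) (map \<sigma> [0..<?r])))"
    using Z by (intro sum.cong) auto
  also have "\<dots> = (\<Sum>is\<in>fibre a m. \<Sum>\<sigma> | \<sigma> permutes {0..<?r}.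
      rho (last (0 # is)) (map ((!) c) (map \<sigma> [0..<?r])))"
    by (rule sum.swap)
  also have "\<dots> = (\<Sum>is\<in>fibre a m. \<Sum>xs\<in>permutations_of_set {0..<?r}. rho (last (0 # is)) (map ((!) c) xs))"
    by (intro sum.cong refl sum_permutes_eq_sum_permutations_of_set)
  also have "\<dots> = (\<Sum>is\<in>fibre a m. \<Prod>i<?r. [:- of_nat (last (0 # is)) - 1 / 2, - 1:] - of_nat i)"
    using c by (intro sum.cong refl) (subst rho_symmetrised; simp)
  finally show ?thesis .
qed

theorem theorem4p8:
  fixes a :: "nat list" and \<delta> :: nat
  assumes "a \<noteq> []" and "0 < \<delta>"
  shows "(0 < last a \<longrightarrow> Zv a (map (\<lambda>x. x + \<delta>) a) = Mser a)
    \<and> (last a = 0 \<longrightarrow> (\<forall>b. length b = length a \<and> (\<forall>y\<in>set b. 0 < y) \<longrightarrow>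
          Zv a (map (\<lambda>x. x + \<delta>) a) = (\<lambda>m. smult (1 / of_nat (symcard a)) (Zsym a b m))))
    \<and> (0 < last a \<longrightarrow> (\<forall>s b. length b = length a \<and> (\<forall>y\<in>set b. 0 < y) \<longrightarrow>
          Zv (a @ replicate s 0) (b @ replicate s \<delta>) = Zv (a @ replicate s 0) (replicate (length a + s) \<delta>)))
    \<and> Zv a (map (\<lambda>x. x + \<delta>) a) = Zv a (replicate (length a) \<delta>)"
proof (intro conjI impI allI)
  obtain a' r where a: "a = a' @ replicate r 0" and a': "a' = [] \<or> 0 < last a'"
    by (rule append_zeros_cases)
  let ?d = "replicate r \<delta>"
  have d: "\<forall>y\<in>set ?d. 0 < y" using assms(2) by simp
  have ne: "a' \<noteq> [] \<or> r \<noteq> 0" using assms(1) a by auto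
  have Z: "Zv a (b @ ?d) m = (\<Sum>is\<in>fibre a' m. rho (last (0 # is)) ?d)"
    if "length b = length a'" for b m
    using Zv_append_zeros[OF a' that d] ne by (simp add: a del: last.simps)
  have lp: "lastpos a = length a'"
    unfolding a using a' by (rule lastpos_append_zeros)
  have len: "length a = length a' + r" by (simp add: a)
  have map_eq: "map (\<lambda>x. x + \<delta>) a = map (\<lambda>x. x + \<delta>) a' @ ?d" by (simp add: a)
  show "Zv a (map (\<lambda>x. x + \<delta>) a) = Zv a (replicate (length a) \<delta>)"
  proof -
    have "replicate (length a) \<delta> = replicate (length a') \<delta> @ ?d"
      by (simp add: a replicate_add)
    then show ?thesis
      by (simp only: fun_eq_iff map_eq Z length_map length_replicate simp_thms)
  qed
  show "Zv a (map (\<lambda>x. x + \<delta>) a) = (\<lambda>m. smult (1 / of_nat (symcard a)) (Zsym a b m))"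
    if b: "length b = length a \<and> (\<forall>y\<in>set b. 0 < y)" for b
  proof
    fix m
    define b' c where "b' = take (length a') b" and "c = drop (length a') b"
    have bc: "b = b' @ c" "length b' = length a'" "length c = r" "\<forall>y\<in>set c. 0 < y"
      using b len by (auto simp: b'_def c_def dest: in_set_dropD)
    have ne': "a' \<noteq> [] \<or> c \<noteq> []" "a' \<noteq> [] \<or> ?d \<noteq> []"
      using ne bc(3) by auto
    have "Zsym a b m = Zsym a (b' @ ?d) m"
      using Zsym_append_zeros[OF a' bc(2,4) ne'(1), of m] Zsym_append_zeros[OF a' bc(2) d ne'(2), of m]
      unfolding a bc(1) bc(3) length_replicate by simp
    also have "\<dots> = (\<Sum>\<sigma> | \<sigma> permutes {0..<r}. Zv a (b' @ ?d) m)"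
    proof -
      have "map (\<lambda>i. ?d ! \<sigma> i) [0..<r] = ?d" if "\<sigma> permutes {0..<r}" for \<sigma>
        using permutes_in_image[OF that] by (intro nth_equalityI) auto
      then have "(\<Sum>\<sigma> | \<sigma> permutes {0..<r}. Zv a (b' @ map (\<lambda>i. ?d ! \<sigma> i) [0..<r]) m)
          = (\<Sum>\<sigma> | \<sigma> permutes {0..<r}. Zv a (b' @ ?d) m)"
        by (intro sum.cong refl) simp
      then show ?thesis
        by (simp add: Zsym_def Let_def lp len bc(2))
    qed
    also have "\<dots> = of_nat (symcard a) * Zv a (map (\<lambda>x. x + \<delta>) a) m"
      by (simp add: symcard_def lp len map_eq Z bc(2) del: last.simps)
    finally have "Zsym a b m = smult (of_nat (symcard a)) (Zv a (map (\<lambda>x. x + \<delta>) a) m)"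
      by (simp add: of_nat_poly)
    moreover have "symcard a \<noteq> 0"
      by (simp add: symcard_def card_permutations)
    ultimately show "Zv a (map (\<lambda>x. x + \<delta>) a) m = smult (1 / of_nat (symcard a)) (Zsym a b m)"
      by simp
  qed
  show "Zv (a @ replicate s 0) (b @ replicate s \<delta>)
      = Zv (a @ replicate s 0) (replicate (length a + s) \<delta>)"
    if "0 < last a" "length b = length a \<and> (\<forall>y\<in>set b. 0 < y)" for s b
  proof
    fix m
    have Zs: "Zv (a @ replicate s 0) (e @ replicate s \<delta>) m
        = (\<Sum>is\<in>fibre a m. rho (last (0 # is)) (replicate s \<delta>))" if "length e = length a" for e
      using Zv_append_zeros[of a e "replicate s \<delta>" m] \<open>0 < last a\<close> assms that
      by (simp del: last.simps)
    show "Zv (a @ replicate s 0) (b @ replicate s \<delta>) m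
        = Zv (a @ replicate s 0) (replicate (length a + s) \<delta>) m"
      using that(2) by (simp add: Zs replicate_add del: last.simps)
  qed
  show "Zv a (map (\<lambda>x. x + \<delta>) a) = Mser a" if "0 < last a"
  proof
    fix m
    have "Zv a (map (\<lambda>x. x + \<delta>) a) m = (\<Sum>is\<in>fibre a m. rho (last (0 # is)) [])"
      using Zv_append_zeros[of a "map (\<lambda>x. x + \<delta>) a" "[]" m] that assms
      by (simp del: last.simps)
    then show "Zv a (map (\<lambda>x. x + \<delta>) a) m = Mser a m"
      by (simp add: rho_def Mser_def fibre_def)
  qed
qed

end
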